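(* Let $\Sigma$ be a smooth fan with $n$ rays and let $\mathcal B=\{b_1,\dots,b_r\}$ be a finite spanning set of a finite-dimensional vector space $E$, with linear ideal of relations $L_{\mathcal B}$ minimally generated by $d$ linear forms. There is a finite fan $\mathcal F$ supported on $\Delta(\Sigma,L_{\mathcal B})$ such that the set of diagrams $D\in\Delta(\Sigma,L_{\mathcal B})$ which, for some minimal generating set $\{\ell_1,\dots,\ell_d\}\subset L_{\mathcal B}$ of linear forms, satisfy (1) $d<|A|+m_A$ for every nonempty $A\subset\{1,\dots,n\}$, and (2) $1+m_{\{i\}}<|B|+m_B$ for every $B\subset\{1,\dots,n\}$ with $|B|\ge2$ and every $i\in B$, is the union of faces of $\mathcal F$. Here $m_A$ depends on $D$ and $\{\ell_1,\dots,\ell_d\}$ as defined in the context.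
   Context: $\mathbf k$ is algebraically closed; $\Sigma$ has rays $\varrho_1,\dots,\varrho_n$. $L_{\mathcal B}\subset\mathbf k[y_1,\dots,y_r]$ is the ideal generated by the linear relations among $b_1,\dots,b_r$, and $\operatorname{Trop}(L_{\mathcal B})\subset\mathbb Q^r$ its tropical variety ($\min$ convention, trivial valuation). An apartment of $\operatorname{Trop}(L_{\mathcal B})$ is $\operatorname{Trop}(L_{\mathcal B})\cap\tau$ for a maximal cone $\tau$ of the Gröbner fan of $L_{\mathcal B}$. $\Delta(\Sigma,L_{\mathcal B})\subset\mathbb Q^{n\times r}$ is the set of matrices $D$ with rows $w_1,\dots,w_n\in\operatorname{Trop}(L_{\mathcal B})$ such that for each $\sigma\in\Sigma$ the rows $w_i$ with $\varrho_i$ a ray of $\sigma$ lie in a common apartment. (Integral such $D$ are the diagrams of toric vector bundles over $Y(\Sigma)$ with fiber $E$ and Khovanskii basis $\mathcal B$.) Given a minimal generating set $\ell_k=\sum_jc_{k,j}y_j$ ($1\le k\le d$) and $D=(w_{i,j})$, for $A\subset\{1,\dots,n\}$ let $M_A$ be the $d\times r$ matrix whose $(k,j)$ entry is $c_{k,j}$ if for all $i\in A$ one has $w_{i,j}=\min\{w_{i,j'}:c_{k,j'}\ne0\}$, and $0$ otherwise; $m_A=\operatorname{rank}(M_A)$. *)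

theory Defs
  imports
    "HOL-Computational_Algebra.Polynomial"
    "HOL-Library.Poly_Mapping"
    "Jordan_Normal_Form.DL_Rank"
begin

section \<open>Rational vector spaces, cones and fans\<close>

text \<open>
  For a finite index set \<open>I\<close>, the space of rational vectors indexed by \<open>I\<close> is modelled by the
  functions that vanish outside \<open>I\<close>.  It is used with \<open>I = {..<m}\<close> and with the matrix index set
  \<open>I = {..<n} \<times> {..<r}\<close>, so that \<open>m\<close>, \<open>n\<close>, \<open>r\<close> may be arbitrary natural numbers.
\<close>

definition qspace :: "'i set \<Rightarrow> ('i \<Rightarrow> rat) set" where
  "qspace I = {x. \<forall>i. i \<notin> I \<longrightarrow> x i = 0}"

definition pairing :: "'i set \<Rightarrow> ('i \<Rightarrow> rat) \<Rightarrow> ('i \<Rightarrow> rat) \<Rightarrow> rat" where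
  "pairing I u x = (\<Sum>i\<in>I. u i * x i)"

definition polyhedral_cone :: "'i set \<Rightarrow> ('i \<Rightarrow> rat) set \<Rightarrow> bool" where
  "polyhedral_cone I \<sigma> \<longleftrightarrow>
     (\<exists>U. finite U \<and> \<sigma> = {x \<in> qspace I. \<forall>u\<in>U. pairing I u x \<ge> 0})"

definition strongly_convex :: "('i \<Rightarrow> rat) set \<Rightarrow> bool" where
  "strongly_convex \<sigma> \<longleftrightarrow> (\<forall>x\<in>\<sigma>. (\<lambda>i. - x i) \<in> \<sigma> \<longrightarrow> x = (\<lambda>_. 0))"

definition is_face :: "'i set \<Rightarrow> ('i \<Rightarrow> rat) set \<Rightarrow> ('i \<Rightarrow> rat) set \<Rightarrow> bool" where
  "is_face I \<tau> \<sigma> \<longleftrightarrow>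
     (\<exists>u. (\<forall>x\<in>\<sigma>. pairing I u x \<ge> 0) \<and> \<tau> = {x\<in>\<sigma>. pairing I u x = 0})"

text \<open>
  Fans in the sense of toric geometry: all cones are strongly convex.  The empty collection is
  allowed, as the fan with empty support.
\<close>

definition is_fan :: "'i set \<Rightarrow> ('i \<Rightarrow> rat) set set \<Rightarrow> bool" where
  "is_fan I \<F> \<longleftrightarrow>
     (\<forall>\<sigma>\<in>\<F>. polyhedral_cone I \<sigma> \<and> strongly_convex \<sigma>) \<and>
     (\<forall>\<sigma>\<in>\<F>. \<forall>\<tau>. is_face I \<tau> \<sigma> \<longrightarrow> \<tau> \<in> \<F>) \<and>
     (\<forall>\<sigma>\<in>\<F>. \<forall>\<tau>\<in>\<F>. is_face I (\<sigma> \<inter> \<tau>) \<sigma> \<and> is_face I (\<sigma> \<inter> \<tau>) \<tau>)"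

definition rays :: "('i \<Rightarrow> rat) set set \<Rightarrow> ('i \<Rightarrow> rat) set set" where
  "rays \<Sigma> = {\<rho>\<in>\<Sigma>. \<exists>v. v \<noteq> (\<lambda>_. 0) \<and> \<rho> = {\<lambda>i. a * v i | a. a \<ge> 0}}"

definition lattice_basis :: "nat \<Rightarrow> (nat \<Rightarrow> nat \<Rightarrow> rat) \<Rightarrow> bool" where
  "lattice_basis m v \<longleftrightarrow>
     (\<forall>k<m. v k \<in> qspace {..<m} \<and> range (v k) \<subseteq> \<int>) \<and>
     (\<forall>x\<in>qspace {..<m}. range x \<subseteq> \<int> \<longrightarrow>
        (\<exists>!a. a \<in> qspace {..<m} \<and> range a \<subseteq> \<int> \<and> x = (\<lambda>i. \<Sum>k<m. a k * v k i)))"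

definition smooth_cone :: "nat \<Rightarrow> (nat \<Rightarrow> rat) set \<Rightarrow> bool" where
  "smooth_cone m \<sigma> \<longleftrightarrow>
     (\<exists>v S. lattice_basis m v \<and> S \<subseteq> {..<m} \<and>
        \<sigma> = {\<lambda>i. \<Sum>k\<in>S. a k * v k i | a. \<forall>k\<in>S. a k \<ge> 0})"

definition smooth_fan :: "nat \<Rightarrow> (nat \<Rightarrow> rat) set set \<Rightarrow> bool" where
  "smooth_fan m \<Sigma> \<longleftrightarrow> is_fan {..<m} \<Sigma> \<and> (\<forall>\<sigma>\<in>\<Sigma>. smooth_cone m \<sigma>)"


section \<open>Polynomials, ideals and initial ideals\<close>

text \<open>
  A polynomial is a finitely supported map from exponent vectors to coefficients; variables are
  indexed from \<open>0\<close>, and \<open>poly_ring r\<close> is the polynomial ring in the first \<open>r\<close> of them.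
\<close>

type_synonym 'k mpol = "(nat \<Rightarrow>\<^sub>0 nat) \<Rightarrow>\<^sub>0 'k"

definition poly_ring :: "nat \<Rightarrow> 'k::comm_ring_1 mpol set" where
  "poly_ring r = {f. \<forall>t\<in>Poly_Mapping.keys f. Poly_Mapping.keys t \<subseteq> {..<r}}"

definition ideal_gen :: "nat \<Rightarrow> 'k::comm_ring_1 mpol set \<Rightarrow> 'k mpol set" where
  "ideal_gen r G =
     {\<Sum>g\<in>G0. h g * g | G0 h. finite G0 \<and> G0 \<subseteq> G \<and> h ` G0 \<subseteq> poly_ring r}"

definition linear_form :: "nat \<Rightarrow> (nat \<Rightarrow> 'k) \<Rightarrow> 'k::comm_ring_1 mpol" where
  "linear_form r c = (\<Sum>j<r. Poly_Mapping.single (Poly_Mapping.single j 1) (c j))"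

definition relation_ideal ::
    "('k::comm_ring_1 \<Rightarrow> 'e \<Rightarrow> 'e::ab_group_add) \<Rightarrow> nat \<Rightarrow> (nat \<Rightarrow> 'e) \<Rightarrow> 'k mpol set" where
  "relation_ideal scale r b =
     ideal_gen r {linear_form r c | c. (\<Sum>j<r. scale (c j) (b j)) = 0}"

text \<open>
  The rows of \<open>c\<close> are the coefficient vectors of \<open>d\<close> distinct linear forms that form an
  inclusion-minimal generating set of the ideal.
\<close>

definition minimal_linear_generators ::
    "nat \<Rightarrow> 'k::comm_ring_1 mpol set \<Rightarrow> nat \<Rightarrow> (nat \<Rightarrow> nat \<Rightarrow> 'k) \<Rightarrow> bool" where
  "minimal_linear_generators r L d c \<longleftrightarrow>
     inj_on (\<lambda>k. linear_form r (c k)) {..<d} \<and>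
     ideal_gen r ((\<lambda>k. linear_form r (c k)) ` {..<d}) = L \<and>
     (\<forall>G. G \<subset> (\<lambda>k. linear_form r (c k)) ` {..<d} \<longrightarrow> ideal_gen r G \<noteq> L)"

definition weight :: "(nat \<Rightarrow> rat) \<Rightarrow> (nat \<Rightarrow>\<^sub>0 nat) \<Rightarrow> rat" where
  "weight w t = (\<Sum>j\<in>Poly_Mapping.keys t. w j * of_nat (Poly_Mapping.lookup t j))"

definition initial_form :: "(nat \<Rightarrow> rat) \<Rightarrow> 'k::comm_ring_1 mpol \<Rightarrow> 'k mpol" where
  "initial_form w f =
     (\<Sum>t | t \<in> Poly_Mapping.keys f \<and> weight w t = Min (weight w ` Poly_Mapping.keys f).
        Poly_Mapping.single t (Poly_Mapping.lookup f t))"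

definition initial_ideal ::
    "nat \<Rightarrow> 'k::comm_ring_1 mpol set \<Rightarrow> (nat \<Rightarrow> rat) \<Rightarrow> 'k mpol set" where
  "initial_ideal r L w = ideal_gen r (initial_form w ` L)"


section \<open>Tropical variety, Groebner fan and apartments\<close>

definition Trop :: "nat \<Rightarrow> 'k::comm_ring_1 mpol set \<Rightarrow> (nat \<Rightarrow> rat) set" where
  "Trop r L =
     {w \<in> qspace {..<r}. \<not> (\<exists>t. Poly_Mapping.single t 1 \<in> initial_ideal r L w)}"

text \<open>The closure in the usual topology of the rational vector space of dimension \<open>r\<close>.\<close>

definition qclosure :: "nat \<Rightarrow> (nat \<Rightarrow> rat) set \<Rightarrow> (nat \<Rightarrow> rat) set" where
  "qclosure r C =
     {w \<in> qspace {..<r}. \<forall>\<epsilon>>0. \<exists>w'\<in>C. \<forall>j<r. \<bar>w' j - w j\<bar> < \<epsilon>}"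

definition groebner_fan :: "nat \<Rightarrow> 'k::comm_ring_1 mpol set \<Rightarrow> (nat \<Rightarrow> rat) set set" where
  "groebner_fan r L =
     (\<lambda>w. qclosure r {w' \<in> qspace {..<r}. initial_ideal r L w' = initial_ideal r L w})
       ` qspace {..<r}"

definition apartments :: "nat \<Rightarrow> 'k::comm_ring_1 mpol set \<Rightarrow> (nat \<Rightarrow> rat) set set" where
  "apartments r L =
     {Trop r L \<inter> \<tau> | \<tau>. \<tau> \<in> groebner_fan r L \<and> (\<forall>\<tau>'\<in>groebner_fan r L. \<not> \<tau> \<subset> \<tau>')}"


section \<open>Diagrams\<close>

definition diag_row :: "(nat \<times> nat \<Rightarrow> rat) \<Rightarrow> nat \<Rightarrow> nat \<Rightarrow> rat" where
  "diag_row D i = (\<lambda>j. D (i, j))"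

text \<open>\<open>\<rho> 0, \<dots>, \<rho> (n - 1)\<close> are the rays of the fan \<open>\<Sigma>\<close> in \<open>m\<close>-dimensional space.\<close>

definition diagrams ::
    "nat \<Rightarrow> (nat \<Rightarrow> rat) set set \<Rightarrow> nat \<Rightarrow> (nat \<Rightarrow> (nat \<Rightarrow> rat) set) \<Rightarrow>
     nat \<Rightarrow> 'k::comm_ring_1 mpol set \<Rightarrow> (nat \<times> nat \<Rightarrow> rat) set" where
  "diagrams m \<Sigma> n \<rho> r L =
     {D \<in> qspace ({..<n} \<times> {..<r}).
        (\<forall>i<n. diag_row D i \<in> Trop r L) \<and>
        (\<forall>\<sigma>\<in>\<Sigma>. \<exists>P\<in>apartments r L. \<forall>i<n. is_face {..<m} (\<rho> i) \<sigma> \<longrightarrow> diag_row D i \<in> P)}"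

definition M_mat ::
    "nat \<Rightarrow> nat \<Rightarrow> (nat \<Rightarrow> nat \<Rightarrow> 'k::field) \<Rightarrow> (nat \<times> nat \<Rightarrow> rat) \<Rightarrow> nat set \<Rightarrow> 'k mat" where
  "M_mat d r c D A = mat d r (\<lambda>(k, j).
     if \<forall>i\<in>A. diag_row D i j = Min {diag_row D i j' | j'. j' < r \<and> c k j' \<noteq> 0} then c k j else 0)"

definition m_rank ::
    "nat \<Rightarrow> nat \<Rightarrow> (nat \<Rightarrow> nat \<Rightarrow> 'k::field) \<Rightarrow> (nat \<times> nat \<Rightarrow> rat) \<Rightarrow> nat set \<Rightarrow> nat" where
  "m_rank d r c D A = vec_space.rank d (M_mat d r c D A)"

end

theory Submission
  imports Defs
begin

text \<open>
  Everything in sight is governed by the order of the entries within each row of a diagram.  Let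
  \<open>H\<close> be the arrangement of the hyperplanes \<open>w\<^sub>i\<^sub>j = w\<^sub>i\<^sub>j\<^sub>'\<close> and \<open>w\<^sub>i\<^sub>j = 0\<close> in the space of
  matrices.  Its closed cells form a complete fan, and a subfan with support
  \<open>X\<close> is obtained as soon as \<open>X\<close> is closed under degeneration, that is, \<open>X\<close> contains with a point also the
  closed cell of that point (\<open>is_fan_cells\<close>, \<open>Union_cells\<close>).  Hence it suffices to show that
  both the set of all diagrams and the set of diagrams satisfying the two conditions are closed
  under degeneration; the cells of the points of the second set are the required faces.

  For the set of all diagrams this is a statement about weights \<open>w\<close> in \<open>r\<close>-dimensional space.  A
  linear ideal has a reduced basis adapted to the order of the coordinates of \<open>w\<close>, obtained by
  expressing the \<open>b\<^sub>j\<close> in a basis of heaviest possible vectors.  Substituting accordingly identifies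
  the initial ideal with the kernel of a substitution of linear forms
  (\<open>initial_ideal_relation_ideal\<close>), which only depends on the order of the coordinates.  It follows
  that the tropical variety and the cones of the Groebner fan are closed under degeneration
  (\<open>Trop_degenerates\<close>, \<open>groebner_cone_degenerates\<close>), and so are the apartments.

  For the two conditions, fix the linear forms.  The rows of the matrix \<open>M\<^sub>A\<close> of a diagram are zero
  or initial forms of the rows of the matrix \<open>M\<^sub>A\<close> of any degeneration, so that \<open>m\<^sub>A\<close> can only
  increase under degeneration (\<open>m_rank_degenerates_mono\<close>).  This preserves the first condition.  The
  second one has \<open>m\<^bsub>{i}\<^esub>\<close> on its smaller side; but the first condition, applied to
  \<open>A = {i}\<close>, says that \<open>m\<^bsub>{i}\<^esub>\<close> equals its maximal value \<open>d\<close>, and then the second condition is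
  preserved as well (\<open>rank_conditions_degenerate\<close>).
\<close>

section \<open>The fan of a hyperplane arrangement\<close>

lemma pairing_add: "pairing I u (\<lambda>i. x i + y i) = pairing I u x + pairing I u y"
  by (simp add: pairing_def sum.distrib algebra_simps)

lemma pairing_scale: "pairing I u (\<lambda>i. a * x i) = a * pairing I u x"
  by (simp add: pairing_def sum_distrib_left algebra_simps)

lemma pairing_uminus_left: "pairing I (\<lambda>i. - u i) x = - pairing I u x"
  by (simp add: pairing_def sum_negf)

lemma pairing_uminus_right: "pairing I u (\<lambda>i. - x i) = - pairing I u x"
  by (simp add: pairing_def sum_negf)

lemma pairing_sum_left: "pairing I (\<lambda>i. \<Sum>h\<in>S. h i) x = (\<Sum>h\<in>S. pairing I h x)"
  unfolding pairing_def sum_distrib_right by (rule sum.swap)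

lemma pairing_unit:
  assumes "finite I" "p \<in> I"
  shows "pairing I (\<lambda>i. if i = p then c else 0) x = c * x p"
proof -
  have "pairing I (\<lambda>i. if i = p then c else 0) x = (\<Sum>i\<in>I. if i = p then c * x i else 0)"
    unfolding pairing_def by (intro sum.cong) auto
  also have "\<dots> = c * x p" using assms by (simp add: sum.delta')
  finally show ?thesis .
qed

text \<open>
  The closed cell of \<open>y\<close> in the central arrangement with normals \<open>H\<close>.  The sets of normals used
  below satisfy \<open>H = - H\<close>, so that an equality \<open>pairing I h y = 0\<close> is inherited by every point of
  the cell.  Membership in cells is the preorder \<open>x\<close> is a degeneration of \<open>y\<close>; unions of closed
  cells are its down-sets.
\<close>

definition cell :: "'i set \<Rightarrow> ('i \<Rightarrow> rat) set \<Rightarrow> ('i \<Rightarrow> rat) \<Rightarrow> ('i \<Rightarrow> rat) set" where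
  "cell I H y = {x \<in> qspace I. \<forall>h\<in>H. pairing I h y \<ge> 0 \<longrightarrow> pairing I h x \<ge> 0}"

lemma cell_trans: "x \<in> cell I H y \<Longrightarrow> cell I H x \<subseteq> cell I H y"
  by (auto simp: cell_def)

lemma cell_refl: "y \<in> qspace I \<Longrightarrow> y \<in> cell I H y"
  by (auto simp: cell_def)

locale arrangement =
  fixes I :: "'i set" and H :: "('i \<Rightarrow> rat) set"
  assumes finite_index: "finite I" and finite_normals: "finite H"
    and normals_uminus: "\<And>h. h \<in> H \<Longrightarrow> (\<lambda>i. - h i) \<in> H"
    and normals_unit: "\<And>p. p \<in> I \<Longrightarrow> (\<lambda>i. if i = p then 1 else 0) \<in> H"
begin

lemma cell_add:
  assumes "x \<in> cell I H y" "x' \<in> cell I H y"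
  shows "(\<lambda>i. x i + x' i) \<in> cell I H y"
  using assms by (auto simp: cell_def qspace_def pairing_add)

lemma cell_nonpos:
  assumes "x \<in> cell I H y" "h \<in> H" "pairing I h y \<le> 0"
  shows "pairing I h x \<le> 0"
proof -
  have "pairing I (\<lambda>i. - h i) y \<ge> 0 \<longrightarrow> pairing I (\<lambda>i. - h i) x \<ge> 0"
    using assms normals_uminus unfolding cell_def by blast
  then show ?thesis using assms(3) by (simp add: pairing_uminus_left)
qed

lemma cell_nonneg:
  assumes "x \<in> cell I H y" "h \<in> H" "pairing I h y \<ge> 0"
  shows "pairing I h x \<ge> 0"
  using assms by (auto simp: cell_def)

lemma polyhedral_cell: "polyhedral_cone I (cell I H y)"
  unfolding polyhedral_cone_def
  by (rule exI[of _ "{h \<in> H. pairing I h y \<ge> 0}"]) (auto simp: cell_def finite_normals)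

text \<open>
  Because the coordinate hyperplanes belong to the arrangement, the sign of each coordinate is
  constant on a cell.
\<close>

lemma strongly_convex_cell: "strongly_convex (cell I H y)"
  unfolding strongly_convex_def
proof (intro ballI impI ext)
  fix x p assume x: "x \<in> cell I H y" "(\<lambda>i. - x i) \<in> cell I H y"
  show "x p = 0"
  proof (cases "p \<in> I")
    case True
    let ?e = "\<lambda>i. if i = p then 1 else 0 :: rat"
    have "pairing I ?e x = 0"
    proof (cases "pairing I ?e y \<ge> 0")
      case True
      then show ?thesis
        using cell_nonneg[OF x(1) normals_unit[OF \<open>p \<in> I\<close>]]
          cell_nonneg[OF x(2) normals_unit[OF \<open>p \<in> I\<close>]]
        by (simp add: pairing_uminus_right)
    next
      case False
      then show ?thesis
        using cell_nonpos[OF x(1) normals_unit[OF \<open>p \<in> I\<close>]]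
          cell_nonpos[OF x(2) normals_unit[OF \<open>p \<in> I\<close>]]
        by (simp add: pairing_uminus_right)
    qed
    then show ?thesis using pairing_unit[OF finite_index True, of 1 x] by simp
  qed (use x in \<open>auto simp: cell_def qspace_def\<close>)
qed

text \<open>
  Serves to move from \<open>z\<close> a little in the direction \<open>- x\<close> without crossing any of the hyperplanes
  that do not contain \<open>z\<close>.
\<close>

lemma small_step:
  "\<exists>\<epsilon>>0. \<forall>h\<in>H. pairing I h z > 0 \<longrightarrow> pairing I h z - \<epsilon> * pairing I h x \<ge> 0"
proof -
  \<comment> \<open>\<open>N\<close> bounds all \<open>pairing I h x\<close>, and \<open>\<delta>\<close> is a positive lower bound for the positive
      values of the normals at \<open>z\<close>; the element \<open>1\<close> is added in case there are none.\<close>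
  define N where "N = 1 + (\<Sum>h\<in>H. \<bar>pairing I h x\<bar>)"
  define P where "P = {pairing I h z | h. h \<in> H \<and> pairing I h z > 0}"
  have P: "finite P" unfolding P_def by (rule finite_image_set) (simp add: finite_normals)
  define \<delta> where "\<delta> = Min (insert 1 P)"
  have "\<delta> \<in> insert 1 P" unfolding \<delta>_def using P by (intro Min_in) auto
  then have \<delta>: "\<delta> > 0" by (auto simp: P_def)
  have N1: "N \<ge> 1" unfolding N_def by (simp add: sum_nonneg)
  show ?thesis
  proof (intro exI[of _ "\<delta> / N"] conjI ballI impI)
    show "\<delta> / N > 0" using \<delta> N1 by simp
    fix h assume h: "h \<in> H" "pairing I h z > 0"
    have "\<bar>pairing I h x\<bar> \<le> (\<Sum>h\<in>H. \<bar>pairing I h x\<bar>)"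
      using h finite_normals by (intro member_le_sum) auto
    then have "\<bar>pairing I h x\<bar> \<le> N" unfolding N_def by linarith
    then have "pairing I h x \<le> N" by linarith
    then have "\<delta> / N * pairing I h x \<le> \<delta> / N * N"
      using \<delta> N1 by (intro mult_left_mono) auto
    also have "\<dots> = \<delta>" using N1 by simp
    also have "\<delta> \<le> pairing I h z"
      unfolding \<delta>_def using P h by (intro Min_le) (auto simp: P_def)
    finally show "pairing I h z - \<delta> / N * pairing I h x \<ge> 0" by simp
  qed
qed

text \<open>
  A face \<open>\<tau>\<close> of a cell is the cell of any point \<open>z\<close> in its relative interior.  Such a point is
  found by maximising the number of normals that do not vanish: on the cell every normal has a
  constant sign, so adding a point of \<open>\<tau>\<close> to \<open>z\<close> never creates a cancellation, and by maximality
  it makes no further normal nonzero.  Conversely, from \<open>z\<close> one can step a little backwards along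
  any \<open>x\<close> in the cell of \<open>z\<close>, so the functional \<open>u\<close> cutting out \<open>\<tau>\<close>, which is nonnegative on
  the big cell and zero at \<open>z\<close>, cannot be positive at \<open>x\<close>.
\<close>

lemma face_of_cell_is_cell:
  assumes y: "y \<in> qspace I" and face: "is_face I \<tau> (cell I H y)"
  shows "\<exists>z\<in>cell I H y. \<tau> = cell I H z"
proof -
  obtain u where u: "\<And>x. x \<in> cell I H y \<Longrightarrow> pairing I u x \<ge> 0"
    and \<tau>: "\<tau> = {x \<in> cell I H y. pairing I u x = 0}"
    using face unfolding is_face_def by blast
  define nz where "nz z = {h \<in> H. pairing I h z \<noteq> 0}" for z
  have "(\<lambda>_. 0) \<in> \<tau>" unfolding \<tau> by (auto simp: cell_def qspace_def pairing_def)
  moreover have "card (nz z) < Suc (card H)" for z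
    using finite_normals unfolding nz_def by (simp add: card_mono le_imp_less_Suc)
  ultimately obtain z where z: "z \<in> \<tau>" and zmax: "\<And>x. x \<in> \<tau> \<Longrightarrow> card (nz x) \<le> card (nz z)"
    using ex_has_greatest_nat[of "\<lambda>z. z \<in> \<tau>" _ "\<lambda>z. card (nz z)" "Suc (card H)"] by (metis less_imp_le)
  have zy: "z \<in> cell I H y" using z \<tau> by auto
  have same: "pairing I h x = 0" if x: "x \<in> \<tau>" and h: "h \<in> H" "pairing I h z = 0" for x h
  proof (rule ccontr)
    assume n: "pairing I h x \<noteq> 0"
    have xy: "x \<in> cell I H y" using x \<tau> by auto
    let ?s = "\<lambda>i. z i + x i"
    have s: "?s \<in> \<tau>" using x z cell_add[OF zy xy] by (auto simp: \<tau> pairing_add)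
    have "nz z \<subseteq> nz ?s"
    proof
      fix g assume g: "g \<in> nz z"
      then have gH: "g \<in> H" by (simp add: nz_def)
      have "pairing I g z + pairing I g x \<noteq> 0"
        using g cell_nonneg[OF zy gH] cell_nonneg[OF xy gH] cell_nonpos[OF zy gH]
          cell_nonpos[OF xy gH] unfolding nz_def by (cases "pairing I g y \<ge> 0") auto
      then show "g \<in> nz ?s" using gH by (simp add: nz_def pairing_add)
    qed
    moreover have "h \<in> nz ?s" "h \<notin> nz z" using h n by (auto simp: nz_def pairing_add)
    ultimately have "nz z \<subset> nz ?s" by blast
    then have "card (nz z) < card (nz ?s)"
      by (rule psubset_card_mono[rotated]) (simp add: nz_def finite_normals)
    then show False using zmax[OF s] by simp
  qed
  have "\<tau> = cell I H z"
  proof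
    show "\<tau> \<subseteq> cell I H z"
    proof
      fix x assume x: "x \<in> \<tau>"
      have xy: "x \<in> cell I H y" using x \<tau> by auto
      have "pairing I h x \<ge> 0" if h: "h \<in> H" "pairing I h z \<ge> 0" for h
      proof (cases "pairing I h z = 0")
        case True
        then show ?thesis using same[OF x h(1)] by simp
      next
        case False
        then have "\<not> pairing I h y \<le> 0" using cell_nonpos[OF zy h(1)] h(2) by auto
        then show ?thesis using cell_nonneg[OF xy h(1)] by simp
      qed
      then show "x \<in> cell I H z" using xy by (auto simp: cell_def)
    qed
    show "cell I H z \<subseteq> \<tau>"
    proof
      fix x assume x: "x \<in> cell I H z"
      have xy: "x \<in> cell I H y" using x cell_trans[OF zy] by auto
      obtain \<epsilon> where \<epsilon>: "\<epsilon> > 0"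
        "\<And>h. h \<in> H \<Longrightarrow> pairing I h z > 0 \<Longrightarrow> pairing I h z - \<epsilon> * pairing I h x \<ge> 0"
        using small_step[of z x] by blast
      have step: "pairing I h (\<lambda>i. z i + (- \<epsilon>) * x i) = pairing I h z - \<epsilon> * pairing I h x" for h
        unfolding pairing_add pairing_scale by simp
      have "(\<lambda>i. z i + (- \<epsilon>) * x i) \<in> cell I H z"
        unfolding cell_def
      proof (intro CollectI conjI ballI impI)
        show "(\<lambda>i. z i + (- \<epsilon>) * x i) \<in> qspace I"
          using zy xy by (auto simp: cell_def qspace_def)
        fix h assume h: "h \<in> H" "pairing I h z \<ge> 0"
        have "pairing I h x = 0" if "pairing I h z = 0"
          using cell_nonneg[OF x h(1)] cell_nonpos[OF x h(1)] that by auto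
        then show "pairing I h (\<lambda>i. z i + (- \<epsilon>) * x i) \<ge> 0"
          unfolding step using \<epsilon>(2)[OF h(1)] h(2) by (cases "pairing I h z = 0") auto
      qed
      then have "pairing I u (\<lambda>i. z i + (- \<epsilon>) * x i) \<ge> 0"
        using u cell_trans[OF zy] by blast
      then have "\<epsilon> * pairing I u x \<le> 0" using z unfolding step \<tau> by simp
      then have "pairing I u x \<le> 0" using \<epsilon>(1) by (simp add: mult_le_0_iff)
      then show "x \<in> \<tau>" using u[OF xy] xy by (simp add: \<tau>)
    qed
  qed
  then show ?thesis using zy by blast
qed

text \<open>
  On the cell of \<open>y\<close> the inequalities of the cell of \<open>z\<close> only add the requirement that certain
  normals vanish, namely those positive at \<open>y\<close> and nonpositive at \<open>z\<close>.  They are all nonnegative on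
  the cell of \<open>y\<close>, so they vanish together exactly where their sum does.
\<close>

lemma cell_Int_is_face: "is_face I (cell I H y \<inter> cell I H z) (cell I H y)"
proof -
  define S where "S = {h \<in> H. pairing I h y > 0 \<and> pairing I h z \<le> 0}"
  define u where "u = (\<lambda>i. \<Sum>h\<in>S. h i)"
  have S: "finite S" by (simp add: S_def finite_normals)
  have u: "pairing I u x = (\<Sum>h\<in>S. pairing I h x)" for x
    unfolding u_def by (rule pairing_sum_left)
  have nonneg: "pairing I h x \<ge> 0" if "x \<in> cell I H y" "h \<in> S" for x h
    using that by (auto simp: S_def cell_def)
  have "x \<in> cell I H z \<longleftrightarrow> pairing I u x = 0" if x: "x \<in> cell I H y" for x
  proof
    assume xz: "x \<in> cell I H z"
    have "pairing I h x = 0" if h: "h \<in> S" for h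
      using nonneg[OF x h] cell_nonpos[OF xz, of h] h by (auto simp: S_def)
    then show "pairing I u x = 0" unfolding u by simp
  next
    assume "pairing I u x = 0"
    then have zero: "pairing I h x = 0" if "h \<in> S" for h
      using that S nonneg[OF x] unfolding u by (simp add: sum_nonneg_eq_0_iff)
    have "pairing I h x \<ge> 0" if h: "h \<in> H" "pairing I h z \<ge> 0" for h
    proof (cases "pairing I h y \<ge> 0")
      case True
      then show ?thesis using cell_nonneg[OF x h(1)] by simp
    next
      case False
      then have "(\<lambda>i. - h i) \<in> S"
        using h normals_uminus by (auto simp: S_def pairing_uminus_left)
      then show ?thesis using zero by (fastforce simp: pairing_uminus_left)
    qed
    then show "x \<in> cell I H z" using x by (auto simp: cell_def)
  qed
  then have "cell I H y \<inter> cell I H z = {x \<in> cell I H y. pairing I u x = 0}" by blast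
  moreover have "\<forall>x\<in>cell I H y. pairing I u x \<ge> 0"
    unfolding u using nonneg by (auto intro: sum_nonneg)
  ultimately show ?thesis unfolding is_face_def by blast
qed

lemma finite_cells: "finite (cell I H ` X)"
proof -
  have "cell I H ` X \<subseteq> (\<lambda>U. {x \<in> qspace I. \<forall>h\<in>U. pairing I h x \<ge> 0}) ` Pow H"
  proof
    fix C assume "C \<in> cell I H ` X"
    then obtain y where C: "C = cell I H y" by blast
    show "C \<in> (\<lambda>U. {x \<in> qspace I. \<forall>h\<in>U. pairing I h x \<ge> 0}) ` Pow H"
      by (rule image_eqI[of _ _ "{h \<in> H. pairing I h y \<ge> 0}"]) (auto simp: C cell_def)
  qed
  then show ?thesis by (rule finite_subset) (simp add: finite_normals)
qed

lemma Union_cells: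
  assumes "X \<subseteq> qspace I" and "\<And>y. y \<in> X \<Longrightarrow> cell I H y \<subseteq> X"
  shows "\<Union>(cell I H ` X) = X"
  using assms cell_refl by fastforce

text \<open>
  Together with \<open>finite_cells\<close> and \<open>Union_cells\<close> this reduces the construction of a fan with
  prescribed support \<open>X\<close> to the closure of \<open>X\<close> under degeneration.
\<close>

lemma is_fan_cells:
  assumes "X \<subseteq> qspace I" and "\<And>y. y \<in> X \<Longrightarrow> cell I H y \<subseteq> X"
  shows "is_fan I (cell I H ` X)"
  unfolding is_fan_def
proof (intro conjI ballI allI impI)
  fix \<sigma> assume "\<sigma> \<in> cell I H ` X"
  then show "polyhedral_cone I \<sigma>" "strongly_convex \<sigma>"
    using polyhedral_cell strongly_convex_cell by auto
next
  fix \<sigma> \<tau> assume "\<sigma> \<in> cell I H ` X" "is_face I \<tau> \<sigma>"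
  then obtain y where y: "y \<in> X" "is_face I \<tau> (cell I H y)" by blast
  then obtain z where "z \<in> cell I H y" "\<tau> = cell I H z"
    using face_of_cell_is_cell assms(1) by blast
  then show "\<tau> \<in> cell I H ` X" using assms(2) y(1) by blast
next
  fix \<sigma> \<tau> assume "\<sigma> \<in> cell I H ` X" "\<tau> \<in> cell I H ` X"
  then show "is_face I (\<sigma> \<inter> \<tau>) \<sigma>" "is_face I (\<sigma> \<inter> \<tau>) \<tau>"
    using cell_Int_is_face by (auto, metis Int_commute)
qed

end

section \<open>Substitution of polynomials for variables\<close>

lemma poly_mapping_sum_singles:
  "(\<Sum>t\<in>Poly_Mapping.keys f. Poly_Mapping.single t (Poly_Mapping.lookup f t)) = f"
  by (rule poly_mapping_eqI)
    (auto simp: lookup_sum lookup_single when_def in_keys_iff sum.delta')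

lemma keys_sum_subset: "Poly_Mapping.keys (sum f S) \<subseteq> (\<Union>s\<in>S. Poly_Mapping.keys (f s))"
proof
  fix t assume "t \<in> Poly_Mapping.keys (sum f S)"
  then have "(\<Sum>s\<in>S. Poly_Mapping.lookup (f s) t) \<noteq> 0" by (simp add: in_keys_iff lookup_sum)
  then obtain s where "s \<in> S" "Poly_Mapping.lookup (f s) t \<noteq> 0" by (meson sum.not_neutral_contains_not_neutral)
  then show "t \<in> (\<Union>s\<in>S. Poly_Mapping.keys (f s))" by (auto simp: in_keys_iff)
qed

definition monomial_subst :: "(nat \<Rightarrow> 'k::comm_ring_1 mpol) \<Rightarrow> (nat \<Rightarrow>\<^sub>0 nat) \<Rightarrow> 'k mpol" where
  "monomial_subst x t = (\<Prod>j\<in>Poly_Mapping.keys t. x j ^ Poly_Mapping.lookup t j)"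

definition subst :: "(nat \<Rightarrow> 'k::comm_ring_1 mpol) \<Rightarrow> 'k mpol \<Rightarrow> 'k mpol" where
  "subst x f = (\<Sum>t\<in>Poly_Mapping.keys f.
     Poly_Mapping.single 0 (Poly_Mapping.lookup f t) * monomial_subst x t)"

lemma monomial_subst_superset:
  assumes "finite S" "Poly_Mapping.keys t \<subseteq> S"
  shows "monomial_subst x t = (\<Prod>j\<in>S. x j ^ Poly_Mapping.lookup t j)"
  unfolding monomial_subst_def
  by (rule prod.mono_neutral_left) (use assms in \<open>auto simp: in_keys_iff\<close>)

lemma monomial_subst_add: "monomial_subst x (s + t) = monomial_subst x s * monomial_subst x t"
proof -
  let ?S = "Poly_Mapping.keys s \<union> Poly_Mapping.keys t"
  have "Poly_Mapping.keys (s + t) \<subseteq> ?S" by (rule keys_add)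
  then show ?thesis
    by (simp add: monomial_subst_superset[of ?S] lookup_add power_add prod.distrib)
qed

lemma monomial_subst_variable [simp]: "monomial_subst x (Poly_Mapping.single j 1) = x j"
  by (simp add: monomial_subst_def)

lemma subst_superset:
  assumes "finite S" "Poly_Mapping.keys f \<subseteq> S"
  shows "subst x f = (\<Sum>t\<in>S. Poly_Mapping.single 0 (Poly_Mapping.lookup f t) * monomial_subst x t)"
  unfolding subst_def
  by (rule sum.mono_neutral_left) (use assms in \<open>auto simp: in_keys_iff\<close>)

lemma subst_zero [simp]: "subst x 0 = 0"
  by (simp add: subst_def)

lemma subst_add: "subst x (f + g) = subst x f + subst x g"
proof -
  let ?S = "Poly_Mapping.keys f \<union> Poly_Mapping.keys g"
  have "Poly_Mapping.keys (f + g) \<subseteq> ?S" by (rule keys_add)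
  then show ?thesis
    by (simp add: subst_superset[of ?S] lookup_add single_add distrib_right sum.distrib)
qed

lemma subst_sum: "subst x (sum f S) = (\<Sum>s\<in>S. subst x (f s))"
  by (induction S rule: infinite_finite_induct) (auto simp: subst_add)

lemma subst_single: "subst x (Poly_Mapping.single t c) = Poly_Mapping.single 0 c * monomial_subst x t"
  by (simp add: subst_def)

lemma subst_mult: "subst x (f * g) = subst x f * subst x g"
proof -
  let ?s = "\<lambda>f t. Poly_Mapping.single t (Poly_Mapping.lookup f t)"
  have "f * g = (\<Sum>s\<in>Poly_Mapping.keys f. ?s f s) * (\<Sum>t\<in>Poly_Mapping.keys g. ?s g t)"
    by (simp only: poly_mapping_sum_singles)
  also have "\<dots> = (\<Sum>s\<in>Poly_Mapping.keys f. \<Sum>t\<in>Poly_Mapping.keys g.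
      Poly_Mapping.single (s + t) (Poly_Mapping.lookup f s * Poly_Mapping.lookup g t))"
    by (simp add: sum_product mult_single)
  finally have "subst x (f * g) = (\<Sum>s\<in>Poly_Mapping.keys f. \<Sum>t\<in>Poly_Mapping.keys g.
      Poly_Mapping.single 0 (Poly_Mapping.lookup f s * Poly_Mapping.lookup g t) * monomial_subst x (s + t))"
    by (simp add: subst_sum subst_single)
  also have "\<dots> = subst x f * subst x g"
    unfolding subst_def sum_product
    by (intro sum.cong refl) (simp add: monomial_subst_add mult_single[of 0 _ 0, simplified, symmetric] algebra_simps)
  finally show ?thesis .
qed

lemma single_eq_monomial_subst:
  "Poly_Mapping.single t 1 = monomial_subst (\<lambda>j. Poly_Mapping.single (Poly_Mapping.single j 1) (1::'k::comm_ring_1)) t"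
proof -
  have pow: "Poly_Mapping.single (Poly_Mapping.single j 1) (1::'k) ^ n = Poly_Mapping.single (Poly_Mapping.single j n) 1"
    for j n :: nat
    by (induction n) (auto simp: mult_single single_add[symmetric])
  have prod: "(\<Prod>j\<in>S. Poly_Mapping.single (u j) (1::'k)) = Poly_Mapping.single (\<Sum>j\<in>S. u j) 1"
    for S :: "nat set" and u :: "nat \<Rightarrow> (nat \<Rightarrow>\<^sub>0 nat)"
    by (induction S rule: infinite_finite_induct) (auto simp: mult_single)
  show ?thesis
    unfolding monomial_subst_def pow prod poly_mapping_sum_singles ..
qed

text \<open>
  The polynomial ring is an integral domain: a substitution kills a monomial only by killing one
  of its variables.  This is how a monomial in a linear ideal yields a variable in it.
\<close>

lemma monomial_subst_eq_0:
  fixes x :: "nat \<Rightarrow> 'k::idom mpol"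
  assumes "monomial_subst x t = 0"
  shows "\<exists>j\<in>Poly_Mapping.keys t. x j = 0"
  using assms by (auto simp: monomial_subst_def)

section \<open>Ideals and substitution\<close>

lemma poly_ring_0 [simp]: "0 \<in> poly_ring r" and poly_ring_1 [simp]: "1 \<in> poly_ring r"
  by (auto simp: poly_ring_def)

lemma poly_ring_constant [simp]: "Poly_Mapping.single 0 c \<in> poly_ring r"
  by (auto simp: poly_ring_def)

lemma poly_ring_add: "f \<in> poly_ring r \<Longrightarrow> g \<in> poly_ring r \<Longrightarrow> f + g \<in> poly_ring r"
  using keys_add[of f g] by (auto simp: poly_ring_def)

lemma poly_ring_mult:
  assumes "f \<in> poly_ring r" "g \<in> poly_ring r"
  shows "f * g \<in> poly_ring r"
  unfolding poly_ring_def
proof (intro CollectI ballI)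
  fix t assume "t \<in> Poly_Mapping.keys (f * g)"
  then obtain s u where "t = s + u" "s \<in> Poly_Mapping.keys f" "u \<in> Poly_Mapping.keys g"
    using keys_mult[of f g] by blast
  then show "Poly_Mapping.keys t \<subseteq> {..<r}"
    using assms keys_add[of s u] unfolding poly_ring_def by blast
qed

lemma poly_ring_sum: "(\<And>s. s \<in> S \<Longrightarrow> f s \<in> poly_ring r) \<Longrightarrow> sum f S \<in> poly_ring r"
  by (induction S rule: infinite_finite_induct) (auto intro: poly_ring_add)

lemma poly_ring_power: "f \<in> poly_ring r \<Longrightarrow> f ^ n \<in> poly_ring r"
  by (induction n) (auto intro: poly_ring_mult)

lemma poly_ring_prod: "(\<And>s. s \<in> S \<Longrightarrow> f s \<in> poly_ring r) \<Longrightarrow> prod f S \<in> poly_ring r"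
  by (induction S rule: infinite_finite_induct) (auto intro: poly_ring_mult)

lemma ideal_gen_subset:
  assumes "G \<subseteq> Q" "0 \<in> Q"
    and "\<And>f g. f \<in> Q \<Longrightarrow> g \<in> Q \<Longrightarrow> f + g \<in> Q"
    and "\<And>h f. h \<in> poly_ring r \<Longrightarrow> f \<in> Q \<Longrightarrow> h * f \<in> Q"
  shows "ideal_gen r G \<subseteq> Q"
proof
  fix f assume "f \<in> ideal_gen r G"
  then obtain G0 h where f: "f = (\<Sum>g\<in>G0. h g * g)" "finite G0" "G0 \<subseteq> G" "h ` G0 \<subseteq> poly_ring r"
    unfolding ideal_gen_def by blast
  have "(\<Sum>g\<in>G0. h g * g) \<in> Q" using f(2-4)
    by (induction G0 rule: finite_induct) (use assms in auto)
  then show "f \<in> Q" by (simp add: f(1))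
qed

lemma ideal_gen_generator: "g \<in> G \<Longrightarrow> g \<in> ideal_gen r G"
  unfolding ideal_gen_def by (intro CollectI exI[of _ "{g}"] exI[of _ "\<lambda>_. 1"]) auto

lemma ideal_gen_0: "0 \<in> ideal_gen r G"
  unfolding ideal_gen_def by (intro CollectI exI[of _ "{}"]) auto

lemma ideal_gen_add:
  assumes "f \<in> ideal_gen r G" "g \<in> ideal_gen r G"
  shows "f + g \<in> ideal_gen r G"
proof -
  obtain F h where f: "f = (\<Sum>g\<in>F. h g * g)" "finite F" "F \<subseteq> G" "h ` F \<subseteq> poly_ring r"
    using assms(1) unfolding ideal_gen_def by blast
  obtain F' h' where g: "g = (\<Sum>g\<in>F'. h' g * g)" "finite F'" "F' \<subseteq> G" "h' ` F' \<subseteq> poly_ring r"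
    using assms(2) unfolding ideal_gen_def by blast
  let ?h = "\<lambda>q. (if q \<in> F then h q else 0) + (if q \<in> F' then h' q else 0)"
  have "f = (\<Sum>q\<in>F \<union> F'. (if q \<in> F then h q else 0) * q)"
    unfolding f(1) by (rule sum.mono_neutral_cong_left) (use f g in auto)
  moreover have "g = (\<Sum>q\<in>F \<union> F'. (if q \<in> F' then h' q else 0) * q)"
    unfolding g(1) by (rule sum.mono_neutral_cong_left) (use f g in auto)
  ultimately have "f + g = (\<Sum>q\<in>F \<union> F'. ?h q * q)"
    by (simp only: distrib_right sum.distrib)
  moreover have "?h ` (F \<union> F') \<subseteq> poly_ring r"
    using f(4) g(4) by (auto simp: image_subset_iff intro!: poly_ring_add)
  ultimately show ?thesis using f g
    unfolding ideal_gen_def by (intro CollectI exI[of _ "F \<union> F'"] exI[of _ ?h]) auto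
qed

lemma ideal_gen_mult:
  assumes "p \<in> poly_ring r" "f \<in> ideal_gen r G"
  shows "p * f \<in> ideal_gen r G"
proof -
  obtain F h where f: "f = (\<Sum>g\<in>F. h g * g)" "finite F" "F \<subseteq> G" "h ` F \<subseteq> poly_ring r"
    using assms(2) unfolding ideal_gen_def by blast
  then have "p * f = (\<Sum>g\<in>F. (p * h g) * g)" by (simp add: sum_distrib_left mult.assoc)
  moreover have "(\<lambda>g. p * h g) ` F \<subseteq> poly_ring r" using f(4) assms(1) poly_ring_mult by blast
  ultimately show ?thesis using f
    unfolding ideal_gen_def by (intro CollectI exI[of _ "F"] exI[of _ "\<lambda>g. p * h g"]) auto
qed

lemma ideal_gen_sum: "(\<And>s. s \<in> S \<Longrightarrow> f s \<in> ideal_gen r G) \<Longrightarrow> sum f S \<in> ideal_gen r G"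
  by (induction S rule: infinite_finite_induct) (auto intro: ideal_gen_add ideal_gen_0)

lemma ideal_gen_in_poly_ring:
  "G \<subseteq> poly_ring r \<Longrightarrow> ideal_gen r G \<subseteq> poly_ring r"
  by (rule ideal_gen_subset) (auto intro: poly_ring_add poly_ring_mult)

lemma ideal_gen_diff_mult:
  assumes "f - f' \<in> ideal_gen r G" "g - g' \<in> ideal_gen r G" "f \<in> poly_ring r" "g' \<in> poly_ring r"
  shows "f * g - f' * g' \<in> ideal_gen r G"
proof -
  have "f * g - f' * g' = f * (g - g') + g' * (f - f')" by (simp add: algebra_simps)
  then show ?thesis using assms by (auto intro: ideal_gen_add ideal_gen_mult)
qed

text \<open>
  Substitution does not change a polynomial modulo an ideal if it does not change the variables
  modulo that ideal.  It identifies the kernel of a substitution with an explicitly generated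
  ideal.
\<close>

lemma subst_cong_ideal:
  fixes f :: "'k::comm_ring_1 mpol"
  assumes "f \<in> poly_ring r"
    and x: "\<And>j. j < r \<Longrightarrow> x j \<in> poly_ring r"
    and cong: "\<And>j. j < r \<Longrightarrow> Poly_Mapping.single (Poly_Mapping.single j 1) 1 - x j \<in> ideal_gen r G"
  shows "f - subst x f \<in> ideal_gen r G"
proof -
  let ?X = "\<lambda>j. Poly_Mapping.single (Poly_Mapping.single j 1) (1::'k)"
  have X: "?X j \<in> poly_ring r" if "j < r" for j using that by (auto simp: poly_ring_def)
  have pow: "?X j ^ n - x j ^ n \<in> ideal_gen r G" if "j < r" for j n
  proof (induction n)
    case (Suc n)
    then show ?case using ideal_gen_diff_mult[OF cong[OF that] Suc.IH] X[OF that] x[OF that]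
      by (simp add: poly_ring_power)
  qed (simp add: ideal_gen_0)
  have prod: "(\<Prod>j\<in>S. ?X j ^ e j) - (\<Prod>j\<in>S. x j ^ e j) \<in> ideal_gen r G"
    if "finite S" "S \<subseteq> {..<r}" for S e
    using that
  proof (induction S rule: finite_induct)
    case (insert j S)
    then have "?X j ^ e j * (\<Prod>j\<in>S. ?X j ^ e j) - x j ^ e j * (\<Prod>j\<in>S. x j ^ e j) \<in> ideal_gen r G"
      by (intro ideal_gen_diff_mult pow poly_ring_power poly_ring_prod X) (auto intro!: x)
    then show ?case using insert by simp
  qed (simp add: ideal_gen_0)
  have "f = (\<Sum>t\<in>Poly_Mapping.keys f. Poly_Mapping.single 0 (Poly_Mapping.lookup f t) * monomial_subst ?X t)"
    by (subst poly_mapping_sum_singles[of f, symmetric], intro sum.cong refl,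
        subst single_eq_monomial_subst[symmetric]) (simp add: mult_single)
  then have "f - subst x f = (\<Sum>t\<in>Poly_Mapping.keys f.
      Poly_Mapping.single 0 (Poly_Mapping.lookup f t) * (monomial_subst ?X t - monomial_subst x t))"
    unfolding subst_def by (simp only: sum_subtractf right_diff_distrib)
  also have "\<dots> \<in> ideal_gen r G"
    unfolding monomial_subst_def
    by (intro ideal_gen_sum ideal_gen_mult prod poly_ring_constant finite_keys)
      (use assms(1) in \<open>auto simp: poly_ring_def\<close>)
  finally show ?thesis .
qed

section \<open>Initial forms and substitution\<close>

lemma weight_add: "weight w (s + t) = weight w s + weight w t"
proof -
  let ?S = "Poly_Mapping.keys s \<union> Poly_Mapping.keys t"
  have sup: "weight w u = (\<Sum>j\<in>?S. w j * of_nat (Poly_Mapping.lookup u j))"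
    if "Poly_Mapping.keys u \<subseteq> ?S" for u
    unfolding weight_def by (rule sum.mono_neutral_left) (use that in \<open>auto simp: in_keys_iff\<close>)
  show ?thesis
    by (simp add: sup keys_add lookup_add sum.distrib distrib_left)
qed

lemma weight_variable [simp]: "weight w (Poly_Mapping.single j 1) = w j"
  by (simp add: weight_def)

text \<open>
  All terms of \<open>f\<close> have weight at least \<open>a\<close>, and \<open>f0\<close> collects those of weight exactly \<open>a\<close>.
  Unlike the initial form, \<open>f0\<close> may vanish; this makes the notion compatible with sums as well as
  with products.
\<close>

definition leading_part :: "(nat \<Rightarrow> rat) \<Rightarrow> rat \<Rightarrow> 'k::comm_ring_1 mpol \<Rightarrow> 'k mpol \<Rightarrow> bool" where
  "leading_part w a f f0 \<longleftrightarrow>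
     (\<forall>t\<in>Poly_Mapping.keys f0. weight w t = a) \<and> (\<forall>t\<in>Poly_Mapping.keys (f - f0). a < weight w t)"

lemma leading_part_lookup:
  "leading_part w a f f0 \<longleftrightarrow>
     (\<forall>t. Poly_Mapping.lookup f t \<noteq> 0 \<longrightarrow> a \<le> weight w t) \<and>
     (\<forall>t. Poly_Mapping.lookup f0 t = (if weight w t = a then Poly_Mapping.lookup f t else 0))"
  unfolding leading_part_def in_keys_iff Ball_def lookup_minus
  by (smt (verit) diff_0_right eq_iff_diff_eq_0 less_le order_refl diff_self)

lemma leading_part_sum:
  assumes "\<And>s. s \<in> S \<Longrightarrow> leading_part w a (f s) (f0 s)"
  shows "leading_part w a (\<Sum>s\<in>S. f s) (\<Sum>s\<in>S. f0 s)"
  using keys_sum_subset[of f0 S] keys_sum_subset[of "\<lambda>s. f s - f0 s" S] assms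
  unfolding leading_part_def by (auto simp: sum_subtractf)

lemma leading_part_mult:
  assumes f: "leading_part w a f f0" and g: "leading_part w b g g0"
  shows "leading_part w (a + b) (f * g) (f0 * g0)"
  unfolding leading_part_def
proof (intro conjI ballI)
  fix t assume "t \<in> Poly_Mapping.keys (f0 * g0)"
  then obtain s u where "t = s + u" "s \<in> Poly_Mapping.keys f0" "u \<in> Poly_Mapping.keys g0"
    using keys_mult[of f0 g0] by blast
  then show "weight w t = a + b" using f g by (simp add: leading_part_def weight_add)
next
  fix t assume t: "t \<in> Poly_Mapping.keys (f * g - f0 * g0)"
  have "f * g - f0 * g0 = (f - f0) * g + f0 * (g - g0)" by (simp add: algebra_simps)
  then have "t \<in> Poly_Mapping.keys ((f - f0) * g) \<or> t \<in> Poly_Mapping.keys (f0 * (g - g0))"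
    using t keys_add[of "(f - f0) * g" "f0 * (g - g0)"] by auto
  then consider s u where "t = s + u" "s \<in> Poly_Mapping.keys (f - f0)" "u \<in> Poly_Mapping.keys g"
    | s u where "t = s + u" "s \<in> Poly_Mapping.keys f0" "u \<in> Poly_Mapping.keys (g - g0)"
    using keys_mult[of "f - f0" g] keys_mult[of f0 "g - g0"] by blast
  then show "a + b < weight w t"
  proof cases
    case 1
    then have "b \<le> weight w u" using g by (auto simp: leading_part_lookup in_keys_iff)
    moreover have "a < weight w s" using 1 f by (auto simp: leading_part_def)
    ultimately show ?thesis using 1 by (simp add: weight_add)
  next
    case 2
    then show ?thesis using f g by (auto simp: weight_add leading_part_def)
  qed
qed

lemma leading_part_constant: "leading_part w 0 (Poly_Mapping.single 0 c) (Poly_Mapping.single 0 c)"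
  by (auto simp: leading_part_def weight_def)

lemma leading_part_monomial_subst:
  assumes "\<And>j. j \<in> Poly_Mapping.keys t \<Longrightarrow> leading_part w (w j) (x j) (x0 j)"
  shows "leading_part w (weight w t) (monomial_subst x t) (monomial_subst x0 t)"
proof -
  have pow: "leading_part w (w j * of_nat n) (x j ^ n) (x0 j ^ n)" if "j \<in> Poly_Mapping.keys t" for j n
  proof (induction n)
    case 0
    show ?case using leading_part_constant[of w 1] by simp
  next
    case (Suc n)
    then show ?case using leading_part_mult[OF assms[OF that] Suc.IH] by (simp add: algebra_simps)
  qed
  have "leading_part w (\<Sum>j\<in>S. w j * of_nat (e j)) (\<Prod>j\<in>S. x j ^ e j) (\<Prod>j\<in>S. x0 j ^ e j)"
    if "finite S" "S \<subseteq> Poly_Mapping.keys t" for S e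
    using that
  proof (induction S rule: finite_induct)
    case empty
    show ?case using leading_part_constant[of w 1] by simp
  next
    case (insert j S)
    then show ?case using leading_part_mult[OF pow[of j "e j"]] by simp
  qed
  then show ?thesis unfolding weight_def monomial_subst_def by simp
qed

lemma lookup_initial_form:
  "Poly_Mapping.lookup (initial_form w f) t =
     (if t \<in> Poly_Mapping.keys f \<and> weight w t = Min (weight w ` Poly_Mapping.keys f)
      then Poly_Mapping.lookup f t else 0)"
  unfolding initial_form_def lookup_sum lookup_single
  by (auto simp: when_def sum.delta)

lemma initial_form_eqI:
  assumes "leading_part w a f f0" "f0 \<noteq> 0"
  shows "initial_form w f = f0"
proof -
  obtain t where "t \<in> Poly_Mapping.keys f0" using assms(2)
    by (metis lookup_zero poly_mapping_eqI in_keys_iff)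
  then have t: "weight w t = a" "t \<in> Poly_Mapping.keys f"
    using assms(1) by (auto simp: leading_part_lookup in_keys_iff split: if_splits)
  have "Min (weight w ` Poly_Mapping.keys f) = a"
    using t assms(1) by (intro Min_eqI) (auto simp: leading_part_lookup in_keys_iff)
  then show ?thesis using assms(1)
    by (intro poly_mapping_eqI) (auto simp: lookup_initial_form leading_part_lookup in_keys_iff)
qed

lemma initial_form_in_poly_ring: "f \<in> poly_ring r \<Longrightarrow> initial_form w f \<in> poly_ring r"
  by (auto simp: poly_ring_def in_keys_iff lookup_initial_form split: if_splits)

text \<open>
  A substitution \<open>x\<close> that does not lower weights has a leading part \<open>x0\<close>.  The part of \<open>subst x f\<close> in
  the minimal weight of \<open>f\<close> only depends on the initial form of \<open>f\<close> and on \<open>x0\<close>: it is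
  \<open>subst x0 (initial_form w f)\<close>.
\<close>

lemma subst_initial_form_eq_0:
  assumes "f \<in> poly_ring r" and x: "\<And>j. j < r \<Longrightarrow> leading_part w (w j) (x j) (x0 j)"
    and "subst x f = 0"
  shows "subst x0 (initial_form w f) = 0"
proof -
  define \<mu> where "\<mu> = Min (weight w ` Poly_Mapping.keys f)"
  let ?c = "\<lambda>t. Poly_Mapping.single 0 (Poly_Mapping.lookup f t)"
  let ?m = "\<lambda>t. if weight w t = \<mu> then ?c t * monomial_subst x0 t else 0"
  have "leading_part w \<mu> (\<Sum>t\<in>Poly_Mapping.keys f. ?c t * monomial_subst x t)
      (\<Sum>t\<in>Poly_Mapping.keys f. ?m t)"
  proof (rule leading_part_sum)
    fix t assume t: "t \<in> Poly_Mapping.keys f"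
    then have "\<mu> \<le> weight w t" by (simp add: \<mu>_def)
    have "leading_part w (0 + weight w t) (?c t * monomial_subst x t) (?c t * monomial_subst x0 t)"
      using t assms(1)
      by (intro leading_part_mult leading_part_constant leading_part_monomial_subst x)
        (auto simp: poly_ring_def)
    then show "leading_part w \<mu> (?c t * monomial_subst x t) (?m t)"
      using \<open>\<mu> \<le> weight w t\<close> by (fastforce simp: leading_part_lookup split: if_splits)
  qed
  moreover have "(\<Sum>t\<in>Poly_Mapping.keys f. ?c t * monomial_subst x t) = 0"
    using assms(3) by (simp add: subst_def)
  moreover have "(\<Sum>t\<in>Poly_Mapping.keys f. ?m t) = subst x0 (initial_form w f)"
    by (subst subst_superset[of "Poly_Mapping.keys f"])
      (auto simp: lookup_initial_form \<mu>_def in_keys_iff intro!: sum.cong)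
  ultimately have "leading_part w \<mu> 0 (subst x0 (initial_form w f))" by simp
  then show ?thesis by (intro poly_mapping_eqI) (auto simp: leading_part_lookup)
qed

section \<open>Initial ideals of ideals of linear relations\<close>

lemma single_index_eq_iff [simp]:
  "Poly_Mapping.single i (Suc 0) = Poly_Mapping.single j (Suc 0) \<longleftrightarrow> i = j"
  by (metis keys_single old.nat.distinct(2) singleton_inject)

lemma lookup_linear_form:
  "Poly_Mapping.lookup (linear_form r c) t = (\<Sum>j<r. c j when Poly_Mapping.single j 1 = t)"
  by (simp add: linear_form_def lookup_sum lookup_single)

lemma keys_linear_form:
  "t \<in> Poly_Mapping.keys (linear_form r c) \<Longrightarrow> \<exists>j<r. t = Poly_Mapping.single j 1"
  using keys_sum_subset[of "\<lambda>j. Poly_Mapping.single (Poly_Mapping.single j 1) (c j)" "{..<r}"]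
  unfolding linear_form_def by (fastforce split: if_splits)

lemma linear_form_in_poly_ring [simp]: "linear_form r c \<in> poly_ring r"
  using keys_linear_form[of _ r c] by (force simp: poly_ring_def)

lemma linear_form_cong: "(\<And>j. j < r \<Longrightarrow> c j = c' j) \<Longrightarrow> linear_form r c = linear_form r c'"
  by (simp add: linear_form_def)

lemma linear_form_diff: "linear_form r c - linear_form r c' = linear_form r (\<lambda>j. c j - c' j)"
  by (simp add: linear_form_def sum_subtractf single_diff)

lemma linear_form_unit:
  "j < r \<Longrightarrow> linear_form r (\<lambda>i. if i = j then 1 else 0) = Poly_Mapping.single (Poly_Mapping.single j 1) 1"
  unfolding linear_form_def
  by (subst sum.remove[of _ j]) auto

lemma linear_form_eq_0_iff: "linear_form r c = 0 \<longleftrightarrow> (\<forall>j<r. c j = 0)"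
proof
  assume zero: "linear_form r c = 0"
  show "\<forall>j<r. c j = 0"
  proof (intro allI impI)
    fix j assume j: "j < r"
    have "Poly_Mapping.lookup (linear_form r c) (Poly_Mapping.single j 1) = c j"
      using j by (simp add: lookup_linear_form when_def)
    then show "c j = 0" using zero by simp
  qed
qed (simp add: linear_form_def)

lemma leading_part_linear_form:
  assumes "\<And>i. i < r \<Longrightarrow> c i \<noteq> 0 \<Longrightarrow> a \<le> w i"
  shows "leading_part w a (linear_form r c) (linear_form r (\<lambda>i. if w i = a then c i else 0))"
  unfolding linear_form_def
proof (rule leading_part_sum)
  fix i assume "i \<in> {..<r}"
  then show "leading_part w a (Poly_Mapping.single (Poly_Mapping.single i 1) (c i))
      (Poly_Mapping.single (Poly_Mapping.single i 1) (if w i = a then c i else 0))"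
    using assms[of i] by (auto simp: leading_part_def simp del: One_nat_def split: if_splits)
qed

lemma subst_linear_form:
  "subst x (linear_form r c) = (\<Sum>j<r. Poly_Mapping.single 0 (c j) * x j)"
  unfolding linear_form_def by (simp add: subst_sum subst_single del: One_nat_def)

lemma subst_linear_forms_linear_form:
  "subst (\<lambda>j. linear_form r (a j)) (linear_form r c) = linear_form r (\<lambda>i. \<Sum>j<r. c j * a j i)"
proof -
  have sing: "Poly_Mapping.single t (\<Sum>j\<in>S. u j) = (\<Sum>j\<in>S. Poly_Mapping.single t (u j))"
    for t :: "nat \<Rightarrow>\<^sub>0 nat" and u :: "nat \<Rightarrow> 'a" and S :: "nat set"
    by (induction S rule: infinite_finite_induct) (auto simp: single_add)
  show ?thesis
    unfolding subst_linear_form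
    unfolding linear_form_def sing sum_distrib_left
    by (subst sum.swap) (simp add: mult_single)
qed

lemma subst_cong:
  assumes "f \<in> poly_ring r" "\<And>j. j < r \<Longrightarrow> x j = y j"
  shows "subst x f = subst y f"
  unfolding subst_def monomial_subst_def
proof (intro sum.cong prod.cong refl arg_cong2[of _ _ _ _ "(*)"] arg_cong2[of _ _ _ _ "(^)"])
  fix t j assume "t \<in> Poly_Mapping.keys f" "j \<in> Poly_Mapping.keys t"
  then show "x j = y j" using assms by (auto simp: poly_ring_def)
qed

text \<open>
  The greedy algorithm: run through the vectors by decreasing weight and keep a vector if it is not
  in the span of those kept so far.  Every vector is then a combination of kept vectors which are at
  least as heavy.  Independence is expressed for the family rather than for the set of vectors, as
  \<open>b\<close> may repeat vectors.
\<close>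

lemma (in vector_space) exists_heavy_basis:
  fixes b :: "nat \<Rightarrow> 'b" and w :: "nat \<Rightarrow> rat"
  assumes "finite S"
  shows "\<exists>K a. K \<subseteq> S \<and> (\<forall>j\<in>S. b j = (\<Sum>i\<in>K. scale (a j i) (b i))) \<and>
    (\<forall>j\<in>S. \<forall>i. a j i \<noteq> 0 \<longrightarrow> i \<in> K \<and> w j \<le> w i) \<and>
    (\<forall>c. (\<Sum>i\<in>K. scale (c i) (b i)) = 0 \<longrightarrow> (\<forall>i\<in>K. c i = 0))"
  using assms
proof (induction S rule: finite_ranking_induct[where f = "\<lambda>j. - w j"])
  case empty
  show ?case by (rule exI[of _ "{}"]) simp
next
  case (insert j S)
  from insert.IH obtain K a where Ka: "K \<subseteq> S" "\<forall>l\<in>S. b l = (\<Sum>i\<in>K. scale (a l i) (b i))"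
    "\<forall>l\<in>S. \<forall>i. a l i \<noteq> 0 \<longrightarrow> i \<in> K \<and> w l \<le> w i"
    "\<forall>c. (\<Sum>i\<in>K. scale (c i) (b i)) = 0 \<longrightarrow> (\<forall>i\<in>K. c i = 0)"
    by (elim exE conjE) (rule that)
  have K: "K \<subseteq> S" "\<And>l. l \<in> S \<Longrightarrow> b l = (\<Sum>i\<in>K. scale (a l i) (b i))"
    "\<And>l i. l \<in> S \<Longrightarrow> a l i \<noteq> 0 \<Longrightarrow> i \<in> K \<and> w l \<le> w i"
    using Ka(1-3) by blast+
  have indep: "c i = 0" if "(\<Sum>i\<in>K. scale (c i) (b i)) = 0" "i \<in> K" for c i
    using Ka(4) that by blast
  have light: "w j \<le> w i" if "i \<in> S" for i using insert.hyps that by fastforce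
  have finK: "finite K" using K(1) insert.hyps(1) finite_subset by blast
  show ?case
  proof (cases "j \<in> S")
    case True
    then have "insert j S = S" by auto
    then show ?thesis using insert.IH by simp
  next
    case jS: False
    show ?thesis
    proof (cases "\<exists>e. b j = (\<Sum>i\<in>K. scale (e i) (b i))")
      case True
      then obtain e where e: "b j = (\<Sum>i\<in>K. scale (e i) (b i))" by blast
      let ?a = "a(j := \<lambda>i. if i \<in> K then e i else 0)"
      have span: "\<forall>l\<in>insert j S. b l = (\<Sum>i\<in>K. scale (?a l i) (b i))"
      proof
        fix l assume "l \<in> insert j S"
        then show "b l = (\<Sum>i\<in>K. scale (?a l i) (b i))"
          using K(2)[of l] e by (cases "l = j") (simp_all cong: sum.cong)
      qed
      have heavy: "\<forall>l\<in>insert j S. \<forall>i. ?a l i \<noteq> 0 \<longrightarrow> i \<in> K \<and> w l \<le> w i"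
      proof (intro ballI allI impI)
        fix l i assume li: "l \<in> insert j S" "?a l i \<noteq> 0"
        show "i \<in> K \<and> w l \<le> w i"
        proof (cases "l = j")
          case True
          then have "i \<in> K" using li(2) by (simp split: if_splits)
          then show ?thesis using True light K(1) by blast
        next
          case False
          then show ?thesis using li K(3) by simp
        qed
      qed
      have "K \<subseteq> insert j S" using K(1) by blast
      then show ?thesis
        by (intro exI[of _ K] exI[of _ ?a] conjI span heavy Ka(4))
    next
      case False
      let ?a = "a(j := \<lambda>i. if i = j then 1 else 0)"
      have jK: "j \<notin> K" using jS K(1) by auto
      have span: "\<forall>l\<in>insert j S. b l = (\<Sum>i\<in>insert j K. scale (?a l i) (b i))"
      proof
        fix l assume l: "l \<in> insert j S"
        show "b l = (\<Sum>i\<in>insert j K. scale (?a l i) (b i))"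
        proof (cases "l = j")
          case True
          have "(\<Sum>i\<in>K. scale (?a j i) (b i)) = 0" using jK by (intro sum.neutral) auto
          then show ?thesis using True finK jK by simp
        next
          case False
          then have "a l j = 0" using K(3)[of l j] l jK by auto
          then show ?thesis using False K(2)[of l] l finK jK by simp
        qed
      qed
      have heavy: "\<forall>l\<in>insert j S. \<forall>i. ?a l i \<noteq> 0 \<longrightarrow> i \<in> insert j K \<and> w l \<le> w i"
      proof (intro ballI allI impI)
        fix l i assume li: "l \<in> insert j S" "?a l i \<noteq> 0"
        show "i \<in> insert j K \<and> w l \<le> w i"
        proof (cases "l = j")
          case True
          then have "i = j" using li(2) by (simp split: if_splits)
          then show ?thesis using True by simp
        next
          case False
          then show ?thesis using li K(3) by simp
        qed
      qed
      have indep': "\<forall>c. (\<Sum>i\<in>insert j K. scale (c i) (b i)) = 0 \<longrightarrow> (\<forall>i\<in>insert j K. c i = 0)"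
      proof (intro allI impI ballI)
        fix c i assume c: "(\<Sum>i\<in>insert j K. scale (c i) (b i)) = 0" and i: "i \<in> insert j K"
        have c': "scale (c j) (b j) + (\<Sum>i\<in>K. scale (c i) (b i)) = 0"
          using c finK jK by simp
        have "c j = 0"
        proof (rule ccontr)
          assume cj: "c j \<noteq> 0"
          have "b j = scale (inverse (c j)) (scale (c j) (b j))" using cj by simp
          also have "scale (c j) (b j) = - (\<Sum>i\<in>K. scale (c i) (b i))"
            using c' by (simp add: eq_neg_iff_add_eq_0)
          also have "scale (inverse (c j)) \<dots> = (\<Sum>i\<in>K. scale (- (inverse (c j) * c i)) (b i))"
            by (simp add: scale_sum_right sum_negf)
          finally have "\<exists>e. b j = (\<Sum>i\<in>K. scale (e i) (b i))"
            by (rule exI[of _ "\<lambda>i. - (inverse (c j) * c i)"])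
          then show False using False by contradiction
        qed
        then show "c i = 0" using c' indep[of c i] i by auto
      qed
      have "insert j K \<subseteq> insert j S" using K(1) by blast
      then show ?thesis
        by (intro exI[of _ "insert j K"] exI[of _ ?a] conjI span heavy indep')
    qed
  qed
qed

text \<open>
  The matrix \<open>a\<close> describes the substitution \<open>y\<^sub>j \<mapsto> \<Sum>\<^sub>i a\<^sub>j\<^sub>i y\<^sub>i\<close> that rewrites each variable in the
  variables of a heaviest basis.  The three clauses say that it changes \<open>y\<^sub>j\<close> by a linear relation,
  that it does not lower weights, and that it kills all linear relations.  Since \<open>w\<close> enters through
  the comparisons \<open>w j \<le> w i\<close> only, the same matrix serves all weights with the same order of
  coordinates.
\<close>

definition heavy_reduction ::
  "('k::field \<Rightarrow> 'e \<Rightarrow> 'e::ab_group_add) \<Rightarrow> nat \<Rightarrow> (nat \<Rightarrow> 'e) \<Rightarrow> (nat \<Rightarrow> rat) \<Rightarrow>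
   (nat \<Rightarrow> nat \<Rightarrow> 'k) \<Rightarrow> bool" where
  "heavy_reduction scale r b w a \<longleftrightarrow>
     (\<forall>j<r. b j = (\<Sum>i<r. scale (a j i) (b i))) \<and>
     (\<forall>j<r. \<forall>i<r. a j i \<noteq> 0 \<longrightarrow> w j \<le> w i) \<and>
     (\<forall>c. (\<Sum>j<r. scale (c j) (b j)) = 0 \<longrightarrow> (\<forall>i<r. (\<Sum>j<r. c j * a j i) = 0))"

lemma heavy_reductionD:
  assumes "heavy_reduction scale r b w a"
  shows heavy_reduction_span: "j < r \<Longrightarrow> b j = (\<Sum>i<r. scale (a j i) (b i))"
    and heavy_reduction_weight: "j < r \<Longrightarrow> i < r \<Longrightarrow> a j i \<noteq> 0 \<Longrightarrow> w j \<le> w i"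
    and heavy_reduction_relation:
      "(\<Sum>j<r. scale (c j) (b j)) = 0 \<Longrightarrow> i < r \<Longrightarrow> (\<Sum>j<r. c j * a j i) = 0"
  using assms unfolding heavy_reduction_def by blast+

lemma (in vector_space) exists_heavy_reduction: "\<exists>a. heavy_reduction scale r b w a"
proof -
  from exists_heavy_basis[OF finite_lessThan, of r b w]
  obtain K a where Ka: "K \<subseteq> {..<r}" "\<forall>l\<in>{..<r}. b l = (\<Sum>i\<in>K. scale (a l i) (b i))"
    "\<forall>l\<in>{..<r}. \<forall>i. a l i \<noteq> 0 \<longrightarrow> i \<in> K \<and> w l \<le> w i"
    "\<forall>c. (\<Sum>i\<in>K. scale (c i) (b i)) = 0 \<longrightarrow> (\<forall>i\<in>K. c i = 0)"
    by (elim exE conjE) (rule that)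
  have K: "K \<subseteq> {..<r}" "\<And>l. l < r \<Longrightarrow> b l = (\<Sum>i\<in>K. scale (a l i) (b i))"
    "\<And>l i. l < r \<Longrightarrow> a l i \<noteq> 0 \<Longrightarrow> i \<in> K \<and> w l \<le> w i"
    using Ka(1-3) by blast+
  have span: "b j = (\<Sum>i<r. scale (a j i) (b i))" if j: "j < r" for j
  proof -
    have "(\<Sum>i\<in>K. scale (a j i) (b i)) = (\<Sum>i<r. scale (a j i) (b i))"
      by (rule sum.mono_neutral_left) (use K(1) K(3)[OF j] in auto)
    with K(2)[OF j] show ?thesis by (rule trans)
  qed
  have rel: "(\<Sum>j<r. c j * a j i) = 0" if c: "(\<Sum>j<r. scale (c j) (b j)) = 0" for c i
  proof (cases "i \<in> K")
    case True
    have "(\<Sum>i\<in>K. scale (\<Sum>j<r. c j * a j i) (b i)) = (\<Sum>i\<in>K. \<Sum>j<r. scale (c j) (scale (a j i) (b i)))"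
      by (simp add: scale_sum_left)
    also have "\<dots> = (\<Sum>j<r. \<Sum>i\<in>K. scale (c j) (scale (a j i) (b i)))" by (rule sum.swap)
    also have "\<dots> = (\<Sum>j<r. scale (c j) (\<Sum>i\<in>K. scale (a j i) (b i)))"
      by (simp only: scale_sum_right)
    also have "\<dots> = (\<Sum>j<r. scale (c j) (b j))"
    proof (rule sum.cong)
      fix j assume "j \<in> {..<r}"
      then show "scale (c j) (\<Sum>i\<in>K. scale (a j i) (b i)) = scale (c j) (b j)"
        by (simp only: K(2)[of j, symmetric] lessThan_iff)
    qed simp
    finally have "(\<Sum>i\<in>K. scale (\<Sum>j<r. c j * a j i) (b i)) = 0" using c by simp
    then show ?thesis using spec[OF Ka(4), of "\<lambda>i. \<Sum>j<r. c j * a j i"] True by simp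
  next
    case False
    then have "a j i = 0" if "j < r" for j using K(3)[OF that] by blast
    then show ?thesis by simp
  qed
  have "heavy_reduction scale r b w a"
    unfolding heavy_reduction_def
  proof (intro conjI allI impI)
    fix j i assume "j < r" "a j i \<noteq> 0"
    then show "w j \<le> w i" using K(3) by blast
  qed (erule span, erule rel)
  then show ?thesis by (rule exI[of _ a])
qed

text \<open>
  The leading part, in weight \<open>w j\<close>, of the image of \<open>y\<^sub>j\<close> under the substitution of a heavy
  reduction.
\<close>

abbreviation initial_reduction :: "nat \<Rightarrow> (nat \<Rightarrow> rat) \<Rightarrow> (nat \<Rightarrow> nat \<Rightarrow> 'k::field) \<Rightarrow> nat \<Rightarrow> 'k mpol" where
  "initial_reduction r w a j \<equiv> linear_form r (\<lambda>i. if w i = w j then a j i else 0)"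

abbreviation reduction_relation :: "nat \<Rightarrow> (nat \<Rightarrow> nat \<Rightarrow> 'k::field) \<Rightarrow> nat \<Rightarrow> 'k mpol" where
  "reduction_relation r a j \<equiv> linear_form r (\<lambda>i. (if i = j then 1 else 0) - a j i)"

lemma linear_relation_in_ideal:
  "(\<Sum>j<r. scale (c j) (b j)) = 0 \<Longrightarrow> linear_form r c \<in> relation_ideal scale r b"
  unfolding relation_ideal_def by (rule ideal_gen_generator) blast

lemma relation_ideal_in_poly_ring: "relation_ideal scale r b \<subseteq> poly_ring r"
  unfolding relation_ideal_def by (rule ideal_gen_in_poly_ring) auto

lemma (in vector_space) reduction_relation_in_ideal:
  assumes "heavy_reduction scale r b w a" "j < r"
  shows "reduction_relation r a j \<in> relation_ideal scale r b"
proof (rule linear_relation_in_ideal)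
  have "(\<Sum>i<r. scale (if i = j then 1 else 0) (b i)) = (\<Sum>i<r. if i = j then b i else 0)"
    by (rule sum.cong) auto
  also have "\<dots> = b j" using assms(2) by simp
  finally show "(\<Sum>i<r. scale ((if i = j then 1 else 0) - a j i) (b i)) = 0"
    by (simp only: scale_left_diff_distrib sum_subtractf heavy_reduction_span[OF assms, symmetric] diff_self)
qed

lemma initial_ideal_generator: "f \<in> L \<Longrightarrow> initial_form w f \<in> initial_ideal r L w"
  unfolding initial_ideal_def by (rule ideal_gen_generator) blast

text \<open>
  The initial ideal of a linear ideal is again linear.  The reduction kills the ideal, so its
  leading part kills all initial forms.  Conversely, modulo the initial forms of the relations
  \<open>y\<^sub>j - \<Sum>\<^sub>i a\<^sub>j\<^sub>i y\<^sub>i\<close> every variable is congruent to its image under the leading part, hence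
  every polynomial killed by the leading part lies in the initial ideal.
\<close>

lemma (in vector_space) initial_ideal_relation_ideal:
  fixes b :: "nat \<Rightarrow> 'b"
  assumes a: "heavy_reduction scale r b w a"
  shows "initial_ideal r (relation_ideal scale r b) w =
    {f \<in> poly_ring r. subst (initial_reduction r w a) f = 0}" (is "?I = ?K")
proof
  let ?L = "relation_ideal scale r b"
  let ?x = "\<lambda>j. linear_form r (a j)"
  have lead: "leading_part w (w j) (?x j) (initial_reduction r w a j)" if "j < r" for j
    using heavy_reduction_weight[OF a that] by (rule leading_part_linear_form)
  have "?L \<subseteq> {f. subst ?x f = 0}"
    unfolding relation_ideal_def
  proof (rule ideal_gen_subset)
    show "{linear_form r c |c. (\<Sum>j<r. scale (c j) (b j)) = 0} \<subseteq> {f. subst ?x f = 0}"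
      using heavy_reduction_relation[OF a]
      by (auto simp: subst_linear_forms_linear_form linear_form_eq_0_iff)
  qed (auto simp: subst_add subst_mult)
  then have "initial_form w ` ?L \<subseteq> ?K"
    using relation_ideal_in_poly_ring subst_initial_form_eq_0[OF _ lead] initial_form_in_poly_ring
    by blast
  then show "?I \<subseteq> ?K"
    unfolding initial_ideal_def
    by (rule ideal_gen_subset) (auto simp: subst_add subst_mult intro: poly_ring_add poly_ring_mult)
  show "?K \<subseteq> ?I"
  proof
    fix f assume f: "f \<in> ?K"
    have "f - subst (initial_reduction r w a) f \<in> ?I"
      unfolding initial_ideal_def
    proof (rule subst_cong_ideal)
      fix j assume j: "j < r"
      let ?y = "Poly_Mapping.single (Poly_Mapping.single j 1) 1 :: 'a mpol"
      show "?y - initial_reduction r w a j \<in> ideal_gen r (initial_form w ` ?L)"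
      proof (cases "?y - initial_reduction r w a j = 0")
        case False
        have lf: "?y - initial_reduction r w a j =
          linear_form r (\<lambda>i. if w i = w j then (if i = j then 1 else 0) - a j i else 0)"
          unfolding linear_form_unit[OF j, symmetric] linear_form_diff by (rule linear_form_cong) auto
        have "leading_part w (w j) (reduction_relation r a j) (?y - initial_reduction r w a j)"
          unfolding lf using heavy_reduction_weight[OF a j]
          by (intro leading_part_linear_form) (auto split: if_splits)
        then have "initial_form w (reduction_relation r a j) = ?y - initial_reduction r w a j"
          using False by (rule initial_form_eqI)
        then show ?thesis
          using ideal_gen_generator[OF imageI[OF reduction_relation_in_ideal[OF a j], of "initial_form w"]]
          by simp
      qed (simp only: ideal_gen_0)
    qed (use f in auto)
    then show "f \<in> ?I" using f by simp
  qed
qed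

section \<open>Degenerations of weights\<close>

text \<open>
  \<open>v\<close> lies in the closed cell of \<open>w\<close> in the braid arrangement: it may have more ties than \<open>w\<close>, but
  never reverses a comparison.
\<close>

definition degenerates :: "nat \<Rightarrow> (nat \<Rightarrow> rat) \<Rightarrow> (nat \<Rightarrow> rat) \<Rightarrow> bool" where
  "degenerates r w v \<longleftrightarrow> (\<forall>i<r. \<forall>j<r. w i \<le> w j \<longrightarrow> v i \<le> v j)"

lemma degenerates_trans: "degenerates r w v \<Longrightarrow> degenerates r v u \<Longrightarrow> degenerates r w u"
  by (auto simp: degenerates_def)

lemma (in vector_space) initial_ideal_cong_order:
  assumes "degenerates r w v" "degenerates r v w"
  shows "initial_ideal r (relation_ideal scale r b) v = initial_ideal r (relation_ideal scale r b) w"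
proof -
  obtain a where a: "heavy_reduction scale r b w a"
    using exists_heavy_reduction[of r b w] by (elim exE) (rule that)
  then have a': "heavy_reduction scale r b v a"
    using assms(1) unfolding heavy_reduction_def degenerates_def by blast
  have "initial_reduction r w a j = initial_reduction r v a j" if "j < r" for j
  proof (rule linear_form_cong)
    fix i assume "i < r"
    then have "w i = w j \<longleftrightarrow> v i = v j"
      using assms that unfolding degenerates_def
      by (auto simp: order_eq_iff[of "w i" "w j"] order_eq_iff[of "v i" "v j"])
    then show "(if w i = w j then a j i else 0) = (if v i = v j then a j i else 0)" by simp
  qed
  then have "subst (initial_reduction r v a) f = subst (initial_reduction r w a) f"
    if "f \<in> poly_ring r" for f
    using that by (intro subst_cong) auto
  then show ?thesis
    unfolding initial_ideal_relation_ideal[OF a] initial_ideal_relation_ideal[OF a'] by auto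
qed

text \<open>
  If the initial ideal for \<open>v\<close> contains a monomial, it contains a variable \<open>y\<^sub>j\<close>, which is the initial
  form of a linear relation all of whose other variables are strictly heavier than \<open>y\<^sub>j\<close>.  These
  strict inequalities persist for every \<open>w\<close> that degenerates to \<open>v\<close>.
\<close>

lemma (in vector_space) Trop_degenerates:
  assumes w: "w \<in> Trop r (relation_ideal scale r b)" and deg: "degenerates r w v" and v: "v \<in> qspace {..<r}"
  shows "v \<in> Trop r (relation_ideal scale r b)"
proof (rule ccontr)
  let ?L = "relation_ideal scale r b"
  assume "v \<notin> Trop r ?L"
  then obtain t where t: "Poly_Mapping.single t 1 \<in> initial_ideal r ?L v" using v by (auto simp: Trop_def)
  obtain a where a: "heavy_reduction scale r b v a"
    using exists_heavy_reduction[of r b v] by (elim exE) (rule that)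
  have "Poly_Mapping.keys t \<subseteq> {..<r}"
    and "monomial_subst (initial_reduction r v a) t = 0"
    using t unfolding initial_ideal_relation_ideal[OF a] by (auto simp: subst_single poly_ring_def)
  then obtain j where j: "j < r" "initial_reduction r v a j = 0"
    using monomial_subst_eq_0[of "initial_reduction r v a" t] by auto
  then have zero: "a j i = 0" if "i < r" "v i = v j" for i
    using that unfolding linear_form_eq_0_iff by (auto split: if_splits)
  have lt: "w j < w i" if i: "i < r" "a j i \<noteq> 0" for i
  proof -
    have "v j \<le> v i" using heavy_reduction_weight[OF a j(1) i] .
    then have "v j < v i" using zero[OF i(1)] i(2) by fastforce
    then have "\<not> w i \<le> w j" using deg i(1) j(1) unfolding degenerates_def by (meson not_le)
    then show ?thesis by simp
  qed
  let ?y = "Poly_Mapping.single (Poly_Mapping.single j 1) 1 :: 'a mpol"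
  have y: "?y = linear_form r (\<lambda>i. if w i = w j then (if i = j then 1 else 0) - a j i else 0)"
    unfolding linear_form_unit[OF j(1), symmetric]
  proof (rule linear_form_cong)
    fix i assume "i < r"
    then have "w i = w j \<Longrightarrow> a j i = 0" using lt by fastforce
    then show "(if i = j then 1 else 0) =
        (if w i = w j then (if i = j then 1 else 0) - a j i else 0)"
      by auto
  qed
  have "leading_part w (w j) (reduction_relation r a j) ?y"
    unfolding y
  proof (rule leading_part_linear_form)
    fix i assume "i < r" "(if i = j then 1 else 0) - a j i \<noteq> 0"
    then show "w j \<le> w i" using lt[of i] by (cases "i = j") auto
  qed
  moreover have "?y \<noteq> 0"
    using lookup_single_eq[of "Poly_Mapping.single j 1" "1::'a"] lookup_zero by (metis one_neq_zero)
  ultimately have "initial_form w (reduction_relation r a j) = ?y"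
    by (rule initial_form_eqI)
  then have "?y \<in> initial_ideal r ?L w"
    using initial_ideal_generator[OF reduction_relation_in_ideal[OF a j(1)], of w] by simp
  then show False using w by (auto simp: Trop_def)
qed

text \<open>
  A point sufficiently close to \<open>v\<close> preserves the finitely many strict inequalities between the
  coordinates of \<open>v\<close>.
\<close>

lemma qclosure_nearby:
  assumes "v \<in> qclosure r C"
  obtains u where "u \<in> C" "degenerates r u v"
proof -
  \<comment> \<open>\<open>\<delta>\<close> is a positive lower bound for the gaps between distinct coordinates of \<open>v\<close>; the element
      \<open>1\<close> is added in case there are none.\<close>
  define P where "P = (\<lambda>(i, j). v j - v i) ` {(i, j) \<in> {..<r} \<times> {..<r}. v i < v j}"
  have P: "finite P" unfolding P_def by (rule finite_imageI, rule finite_subset[of _ "{..<r} \<times> {..<r}"]) auto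
  define \<delta> where "\<delta> = Min (insert 1 P)"
  have "\<delta> \<in> insert 1 P" unfolding \<delta>_def using P by (intro Min_in) auto
  then have \<delta>: "\<delta> > 0" by (auto simp: P_def)
  then obtain u where u: "u \<in> C" "\<And>j. j < r \<Longrightarrow> \<bar>u j - v j\<bar> < \<delta> / 2"
    using assms unfolding qclosure_def by (auto dest: spec[of _ "\<delta> / 2"])
  have "u i < u j" if ij: "i < r" "j < r" "v i < v j" for i j
  proof -
    have "\<delta> \<le> v j - v i" unfolding \<delta>_def using ij P by (intro Min_le) (auto simp: P_def intro!: image_eqI[of _ _ "(i, j)"])
    then show ?thesis using u(2)[OF ij(1)] u(2)[OF ij(2)] by linarith
  qed
  then have "degenerates r u v" unfolding degenerates_def by (meson not_le)
  then show ?thesis using that u(1) by blast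
qed

text \<open>
  The relatively open cone of \<open>w\<close> is a union of open cells of the braid arrangement, since the
  initial ideal only depends on the order of the coordinates.  The closure of such a union consists
  of closed cells: if \<open>u\<close> in the open cone degenerates to \<open>v'\<close>, the points \<open>v' + \<delta> u\<close> order their
  coordinates as \<open>u\<close> does and converge to \<open>v'\<close>.
\<close>

lemma (in vector_space) groebner_cone_degenerates:
  assumes \<tau>: "\<tau> \<in> groebner_fan r (relation_ideal scale r b)"
    and v: "v \<in> \<tau>" and deg: "degenerates r v v'" and v': "v' \<in> qspace {..<r}"
  shows "v' \<in> \<tau>"
proof -
  let ?in = "initial_ideal r (relation_ideal scale r b)"
  obtain w where w: "\<tau> = qclosure r {u \<in> qspace {..<r}. ?in u = ?in w}"
    using \<tau> unfolding groebner_fan_def by blast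
  have "v \<in> qclosure r {u \<in> qspace {..<r}. ?in u = ?in w}" using v unfolding w .
  then obtain u where "u \<in> {u \<in> qspace {..<r}. ?in u = ?in w}" and deg_u: "degenerates r u v"
    by (rule qclosure_nearby)
  then have u: "u \<in> qspace {..<r}" "?in u = ?in w" by simp_all
  have uv': "degenerates r u v'" using deg_u deg by (rule degenerates_trans)
  show ?thesis unfolding w qclosure_def
  proof (intro CollectI conjI allI impI v')
    fix \<epsilon> :: rat assume \<epsilon>: "\<epsilon> > 0"
    \<comment> \<open>\<open>N\<close> exceeds all coordinates of \<open>u\<close>, so a step of length \<open>\<epsilon> / N\<close> stays within \<open>\<epsilon>\<close>.\<close>
    define N where "N = 1 + (\<Sum>j<r. \<bar>u j\<bar>)"
    have N: "N \<ge> 1" unfolding N_def by (simp add: sum_nonneg)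
    define \<delta> where "\<delta> = \<epsilon> / N"
    have \<delta>: "\<delta> > 0" using \<epsilon> N by (simp add: \<delta>_def)
    let ?z = "\<lambda>j. v' j + \<delta> * u j"
    have "degenerates r u ?z"
      unfolding degenerates_def
    proof (intro allI impI)
      fix i j assume ij: "i < r" "j < r" "u i \<le> u j"
      then have "v' i \<le> v' j" using uv' unfolding degenerates_def by blast
      moreover have "\<delta> * u i \<le> \<delta> * u j" using ij \<delta> by simp
      ultimately show "?z i \<le> ?z j" by (rule add_mono)
    qed
    moreover have "degenerates r ?z u"
      unfolding degenerates_def
    proof (intro allI impI, rule ccontr)
      fix i j assume ij: "i < r" "j < r" "?z i \<le> ?z j" "\<not> u i \<le> u j"
      then have "v' j \<le> v' i" using uv' unfolding degenerates_def by (meson nle_le)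
      moreover have "\<delta> * u j < \<delta> * u i" using ij \<delta> by simp
      ultimately show False using ij(3) by linarith
    qed
    ultimately have "?in ?z = ?in u" by (rule initial_ideal_cong_order)
    then have "?in ?z = ?in w" using u(2) by (rule trans)
    moreover have "?z \<in> qspace {..<r}" using v' u(1) by (auto simp: qspace_def)
    moreover have "\<bar>?z j - v' j\<bar> < \<epsilon>" if j: "j < r" for j
    proof -
      have "\<bar>u j\<bar> \<le> (\<Sum>j<r. \<bar>u j\<bar>)" using j by (intro member_le_sum) auto
      then have "\<bar>u j\<bar> < N" unfolding N_def by linarith
      then have "\<delta> * \<bar>u j\<bar> < \<delta> * N" using \<delta> by simp
      also have "\<delta> * N = \<epsilon>" using N by (simp add: \<delta>_def)
      finally show ?thesis using \<delta> by (simp add: abs_mult)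
    qed
    ultimately show "\<exists>u'\<in>{u \<in> qspace {..<r}. ?in u = ?in w}. \<forall>j<r. \<bar>u' j - v' j\<bar> < \<epsilon>"
      by (intro bexI[of _ ?z]) simp_all
  qed
qed

lemma (in vector_space) apartment_degenerates:
  assumes "P \<in> apartments r (relation_ideal scale r b)"
    and "v \<in> P" "degenerates r v v'" "v' \<in> qspace {..<r}"
  shows "v' \<in> P"
proof -
  obtain \<tau> where "P = Trop r (relation_ideal scale r b) \<inter> \<tau>"
    and "\<tau> \<in> groebner_fan r (relation_ideal scale r b)"
    using assms(1) unfolding apartments_def by blast
  then show ?thesis
    using assms(2) Trop_degenerates[OF _ assms(3,4)] groebner_cone_degenerates[OF _ _ assms(3,4)]
    by simp
qed

section \<open>Ranks of initial matrices\<close>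

context vec_space
begin

text \<open>
  Translates the linear independence of a set of vectors, in which equal columns would be
  identified, into the triviality of the kernel of the matrix on the chosen column indices.
\<close>

lemma independent_columns_iff:
  assumes M: "M \<in> carrier_mat n nc" and J: "J \<subseteq> {..<nc}"
  shows "inj_on (col M) J \<and> lin_indpt (col M ` J) \<longleftrightarrow>
    (\<forall>x. (\<forall>k<n. (\<Sum>j\<in>J. x j * M $$ (k, j)) = 0) \<longrightarrow> (\<forall>j\<in>J. x j = 0))"
    (is "?indep \<longleftrightarrow> ?kernel")
proof -
  have fin: "finite J" using J finite_subset by blast
  have carrier: "col M ` J \<subseteq> carrier_vec n" using M J by auto
  have entry: "col M j $ k = M $$ (k, j)" if "j \<in> J" "k < n" for j k
    using that M J by auto
  show ?thesis
  proof
    assume indep: ?indep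
    show ?kernel
    proof (intro allI impI ballI)
      fix x j assume x: "\<forall>k<n. (\<Sum>j\<in>J. x j * M $$ (k, j)) = 0" and j: "j \<in> J"
      let ?a = "\<lambda>v. x (inv_into J (col M) v)"
      have inv: "inv_into J (col M) (col M j) = j" if "j \<in> J" for j
        using indep that by (simp add: inv_into_f_f)
      have "lincomb ?a (col M ` J) = 0\<^sub>v n"
      proof (rule eq_vecI)
        show "dim_vec (lincomb ?a (col M ` J)) = dim_vec (0\<^sub>v n)"
          using lincomb_dim[OF _ carrier] fin by simp
        fix k assume "k < dim_vec (0\<^sub>v n :: 'a vec)"
        then have k: "k < n" by simp
        have "lincomb ?a (col M ` J) $ k = (\<Sum>v\<in>col M ` J. ?a v * v $ k)"
          by (rule lincomb_index[OF k carrier])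
        also have "\<dots> = (\<Sum>j\<in>J. x j * M $$ (k, j))"
          using indep k by (simp add: sum.reindex inv entry)
        finally show "lincomb ?a (col M ` J) $ k = 0\<^sub>v n $ k" using x k by simp
      qed
      then have zero: "lincomb ?a (col M ` J) = 0\<^sub>v n" .
      show "x j = 0"
      proof (rule ccontr)
        assume "x j \<noteq> 0"
        then have "?a (col M j) \<noteq> 0" by (simp only: inv[OF j] not_False_eq_True)
        then have "lin_dep (col M ` J)"
          by (rule lin_dep_crit[where A = "col M ` J" and S = "col M ` J" and a = ?a and v = "col M j",
            OF finite_imageI[OF fin] subset_refl TrueI imageI[OF j] _ zero])
        with indep show False by (elim conjE notE)
      qed
    qed
  next
    assume kernel: ?kernel
    have inj: "inj_on (col M) J"
    proof (rule inj_onI, rule ccontr)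
      fix i j assume ij: "i \<in> J" "j \<in> J" "col M i = col M j" "i \<noteq> j"
      \<comment> \<open>Two equal columns give a kernel vector with entries \<open>1\<close> and \<open>- 1\<close>.\<close>
      let ?x = "\<lambda>l. if l = i then 1 else if l = j then -1 else (0 :: 'a)"
      have "(\<Sum>l\<in>J. ?x l * M $$ (k, l)) = 0" if k: "k < n" for k
      proof -
        have "(\<Sum>l\<in>J. ?x l * M $$ (k, l)) = (\<Sum>l\<in>{i, j}. ?x l * M $$ (k, l))"
          by (rule sum.mono_neutral_right) (use fin ij(1,2) in auto)
        also have "\<dots> = M $$ (k, i) - M $$ (k, j)" using ij(4) by simp
        also have "M $$ (k, i) = M $$ (k, j)"
          unfolding entry[OF ij(1) k, symmetric] entry[OF ij(2) k, symmetric] ij(3) ..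
        also have "M $$ (k, j) - M $$ (k, j) = 0" by simp
        finally show ?thesis .
      qed
      with spec[OF kernel, of ?x] have "?x i = 0" using ij(1) by blast
      then show False by simp
    qed
    have "lin_indpt (col M ` J)"
    proof (rule finite_lin_indpt2)
      show "finite (col M ` J)" using fin by simp
      show "col M ` J \<subseteq> carrier_vec n" by (rule carrier)
      fix a assume zero: "lincomb a (col M ` J) = 0\<^sub>v n"
      have "(\<Sum>j\<in>J. a (col M j) * M $$ (k, j)) = 0" if k: "k < n" for k
      proof -
        have "(\<Sum>j\<in>J. a (col M j) * M $$ (k, j)) = (\<Sum>v\<in>col M ` J. a v * v $ k)"
          using inj k by (simp add: sum.reindex entry)
        also have "\<dots> = lincomb a (col M ` J) $ k" by (rule lincomb_index[OF k carrier, symmetric])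
        finally show ?thesis using zero k by simp
      qed
      with spec[OF kernel, of "\<lambda>j. a (col M j)"]
      show "\<forall>v\<in>col M ` J. a v = 0" by simp
    qed
    then show ?indep using inj by blast
  qed
qed

lemma rank_independent_columns:
  assumes M: "M \<in> carrier_mat n nc"
  obtains J where "J \<subseteq> {..<nc}" "card J = rank M" "inj_on (col M) J" "lin_indpt (col M ` J)"
proof -
  obtain S where S: "maximal S (\<lambda>T. T \<subseteq> set (cols M) \<and> lin_indpt T)"
    using maximal_exists_superset[of "set (cols M)" "\<lambda>T. T \<subseteq> set (cols M) \<and> lin_indpt T" "{}"]
    by (auto simp: lin_dep_def)
  have cols: "set (cols M) = col M ` {..<nc}" using M by (auto simp: cols_def)
  have Ssub: "S \<subseteq> col M ` {..<nc}" "lin_indpt S" using S cols by (auto simp: maximal_def)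
  then obtain J where "J \<subseteq> {..<nc}" "inj_on (col M) J" "S = col M ` J"
    by (auto simp: subset_image_inj)
  then show ?thesis using that[of J] Ssub rank_card_indpt[OF M S] by (simp add: card_image)
qed

lemma rank_le_dim_row:
  assumes M: "M \<in> carrier_mat n nc"
  shows "rank M \<le> n"
proof -
  obtain J where J: "J \<subseteq> {..<nc}" "card J = rank M" "inj_on (col M) J" "lin_indpt (col M ` J)"
    using rank_independent_columns[OF M] .
  have "col M ` J \<subseteq> carrier_vec n" using M J(1) by auto
  then have "card (col M ` J) \<le> dim" using li_le_dim(2)[OF fin_dim] J(4) by simp
  then show ?thesis using J by (simp add: card_image dim_is_n)
qed

text \<open>
  Each row of \<open>M\<close> is zero or the lowest part of the corresponding row of \<open>M'\<close>.  Columns that are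
  independent in \<open>M\<close> are independent in \<open>M'\<close>: for a vector \<open>x\<close> in the kernel of \<open>M'\<close>, let \<open>x\<^sup>+\<close> be
  the part of \<open>x\<close> on its nonzero coordinates of maximal weight \<open>\<omega>\<close>; then \<open>x\<^sup>+\<close> lies in the kernel
  of \<open>M\<close>.  Indeed, a row of \<open>M\<close> is supported on a single weight \<open>\<mu>\<close>.  If \<open>\<mu> \<noteq> \<omega>\<close>, it meets only
  zeros of \<open>x\<^sup>+\<close>.  If \<open>\<mu> = \<omega>\<close>, the further entries in the row of \<open>M'\<close> have weight above \<open>\<omega>\<close> and
  meet zeros of \<open>x\<close>, so the product of the row with \<open>x\<^sup>+\<close> agrees with that of the row of \<open>M'\<close>
  with \<open>x\<close>.
\<close>

lemma rank_initial_matrix_le: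
  fixes w :: "nat \<Rightarrow> rat"
  assumes M: "M \<in> carrier_mat n nc" and M': "M' \<in> carrier_mat n nc"
    and rows: "\<And>k. k < n \<Longrightarrow> (\<forall>j<nc. M $$ (k, j) = 0) \<or>
      (\<exists>\<mu>. \<forall>j<nc. M $$ (k, j) = (if w j = \<mu> then M' $$ (k, j) else 0) \<and>
        (M' $$ (k, j) \<noteq> 0 \<longrightarrow> \<mu> \<le> w j))"
  shows "rank M \<le> rank M'"
proof -
  obtain J where J: "J \<subseteq> {..<nc}" "card J = rank M" "inj_on (col M) J" "lin_indpt (col M ` J)"
    using rank_independent_columns[OF M] .
  have fin: "finite J" using J(1) finite_subset by blast
  have ker: "\<forall>j\<in>J. x j = 0" if "\<And>k. k < n \<Longrightarrow> (\<Sum>j\<in>J. x j * M $$ (k, j)) = 0" for x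
    using independent_columns_iff[OF M J(1)] J(3,4) that by blast
  have "\<forall>j\<in>J. x j = 0" if x: "\<forall>k<n. (\<Sum>j\<in>J. x j * M' $$ (k, j)) = 0" for x
  proof (rule ccontr)
    assume "\<not> (\<forall>j\<in>J. x j = 0)"
    then have ne: "{j \<in> J. x j \<noteq> 0} \<noteq> {}" by auto
    define \<omega> where "\<omega> = Max (w ` {j \<in> J. x j \<noteq> 0})"
    have le: "w j \<le> \<omega>" if "j \<in> J" "x j \<noteq> 0" for j
      unfolding \<omega>_def using that fin by (intro Max_ge) auto
    have "\<omega> \<in> w ` {j \<in> J. x j \<noteq> 0}"
      unfolding \<omega>_def using ne fin by (intro Max_in) auto
    then obtain j0 where j0: "j0 \<in> J" "x j0 \<noteq> 0" "w j0 = \<omega>" by auto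
    let ?y = "\<lambda>j. if w j = \<omega> then x j else 0"
    have "(\<Sum>j\<in>J. ?y j * M $$ (k, j)) = 0" if k: "k < n" for k
    proof (cases "\<forall>j<nc. M $$ (k, j) = 0")
      case True
      then show ?thesis using J(1) by (intro sum.neutral) auto
    next
      case False
      then obtain \<mu> where \<mu>: "\<And>j. j < nc \<Longrightarrow> M $$ (k, j) = (if w j = \<mu> then M' $$ (k, j) else 0)"
        "\<And>j. j < nc \<Longrightarrow> M' $$ (k, j) \<noteq> 0 \<Longrightarrow> \<mu> \<le> w j"
        using rows[OF k] by blast
      show ?thesis
      proof (cases "\<mu> = \<omega>")
        case True
        have "(\<Sum>j\<in>J. ?y j * M $$ (k, j)) = (\<Sum>j\<in>J. x j * M' $$ (k, j))"
        proof (rule sum.cong)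
          fix j assume j: "j \<in> J"
          then have "j < nc" using J(1) by auto
          then have "w j \<noteq> \<omega> \<Longrightarrow> x j = 0 \<or> M' $$ (k, j) = 0"
            using \<mu>(2)[of j] le[OF j] True by force
          then show "?y j * M $$ (k, j) = x j * M' $$ (k, j)"
            using \<mu>(1)[OF \<open>j < nc\<close>] True by auto
        qed simp
        then show ?thesis using x k by simp
      next
        case False
        then show ?thesis using J(1) \<mu>(1) by (intro sum.neutral) auto
      qed
    qed
    then have "?y j0 = 0" using ker[of ?y] j0(1) by blast
    then show False using j0 by simp
  qed
  then have "inj_on (col M') J \<and> lin_indpt (col M' ` J)"
    using independent_columns_iff[OF M' J(1)] by blast
  moreover have "col M' ` J \<subseteq> set (cols M')" using M' J(1) by (auto simp: cols_def)
  ultimately show ?thesis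
    using rank_ge_card_indpt[OF M', of "col M' ` J"] J(2) by (simp add: card_image)
qed

end

section \<open>Degenerations of diagrams\<close>

text \<open>
  The coordinate hyperplanes, together with the braid arrangement in each row.  The former make the
  cells strongly convex, the latter record the order of the entries within each row.
\<close>

definition diagram_normals :: "nat \<Rightarrow> nat \<Rightarrow> (nat \<times> nat \<Rightarrow> rat) set" where
  "diagram_normals n r =
     {\<lambda>q. if q = p then c else 0 | p c. p \<in> {..<n} \<times> {..<r} \<and> c \<in> {1, -1}} \<union>
     {\<lambda>q. (if q = (i, j) then 1 else 0) - (if q = (i, j') then 1 else 0) | i j j'.
        i < n \<and> j < r \<and> j' < r}"

lemma arrangement_diagram_normals: "arrangement ({..<n} \<times> {..<r}) (diagram_normals n r)"
proof
  show "finite ({..<n} \<times> {..<r})" by simp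
  have "diagram_normals n r \<subseteq>
      (\<lambda>(p, c) q. if q = p then c else 0) ` (({..<n} \<times> {..<r}) \<times> {1, -1}) \<union>
      (\<lambda>(i, j, j') q. (if q = (i, j) then 1 else 0) - (if q = (i, j') then 1 else 0)) `
        ({..<n} \<times> {..<r} \<times> {..<r})" (is "_ \<subseteq> ?U")
    unfolding diagram_normals_def by (intro Un_mono subsetI) (force simp: image_iff)+
  moreover have "finite ?U" by simp
  ultimately show "finite (diagram_normals n r)" by (rule finite_subset)
  show "(\<lambda>i. if i = p then 1 else 0) \<in> diagram_normals n r" if "p \<in> {..<n} \<times> {..<r}" for p
    unfolding diagram_normals_def using that by blast
  fix h assume "h \<in> diagram_normals n r"
  then consider p c where "p \<in> {..<n} \<times> {..<r}" "c \<in> {1, -1}" "h = (\<lambda>q. if q = p then c else 0)"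
    | i j j' where "i < n" "j < r" "j' < r"
      "h = (\<lambda>q. (if q = (i, j) then 1 else 0) - (if q = (i, j') then 1 else 0))"
    unfolding diagram_normals_def by blast
  then show "(\<lambda>q. - h q) \<in> diagram_normals n r"
  proof cases
    case 1
    then have "(\<lambda>q. - h q) = (\<lambda>q. if q = p then - c else 0)" "- c \<in> {1, -1}" by auto
    then show ?thesis unfolding diagram_normals_def using 1(1) by blast
  next
    case 2
    then have "(\<lambda>q. - h q) = (\<lambda>q. (if q = (i, j') then 1 else 0) - (if q = (i, j) then 1 else 0))"
      by auto
    then show ?thesis unfolding diagram_normals_def using 2(1-3) by blast
  qed
qed

lemma diagram_cell_degenerates:
  assumes D': "D' \<in> cell ({..<n} \<times> {..<r}) (diagram_normals n r) D" and i: "i < n"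
  shows "degenerates r (diag_row D i) (diag_row D' i)"
  unfolding degenerates_def diag_row_def
proof (intro allI impI)
  fix j j' assume j: "j < r" "j' < r" and le: "D (i, j) \<le> D (i, j')"
  let ?I = "{..<n} \<times> {..<r}"
  let ?h = "\<lambda>q. (if q = (i, j') then 1 else 0) - (if q = (i, j) then 1 else 0) :: rat"
  have h: "pairing ?I ?h x = x (i, j') - x (i, j)" for x
  proof -
    have "pairing ?I ?h x = pairing ?I (\<lambda>q. if q = (i, j') then 1 else 0) x
        - pairing ?I (\<lambda>q. if q = (i, j) then 1 else 0) x"
      unfolding pairing_def left_diff_distrib by (rule sum_subtractf)
    then show ?thesis using i j by (simp add: pairing_unit)
  qed
  have "?h \<in> diagram_normals n r" unfolding diagram_normals_def using i j by blast
  moreover have "pairing ?I ?h D \<ge> 0" unfolding h using le by simp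
  ultimately have "pairing ?I ?h D' \<ge> 0" using D' unfolding cell_def by blast
  then show "D' (i, j) \<le> D' (i, j')" unfolding h by simp
qed

lemma (in vector_space) diagrams_cell_closed:
  assumes D: "D \<in> diagrams m \<Sigma> n \<rho> r (relation_ideal scale r b)"
    and D': "D' \<in> cell ({..<n} \<times> {..<r}) (diagram_normals n r) D"
  shows "D' \<in> diagrams m \<Sigma> n \<rho> r (relation_ideal scale r b)"
proof -
  let ?L = "relation_ideal scale r b"
  have D'q: "D' \<in> qspace ({..<n} \<times> {..<r})" using D' by (simp add: cell_def)
  then have row: "diag_row D' i \<in> qspace {..<r}" for i
    by (auto simp: qspace_def diag_row_def)
  show ?thesis unfolding diagrams_def
  proof (intro CollectI conjI D'q allI impI ballI)
    fix i assume i: "i < n"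
    then have "diag_row D i \<in> Trop r ?L" using D by (simp add: diagrams_def)
    then show "diag_row D' i \<in> Trop r ?L"
      using diagram_cell_degenerates[OF D' i] row by (rule Trop_degenerates)
  next
    fix \<sigma> assume "\<sigma> \<in> \<Sigma>"
    then obtain P where P: "P \<in> apartments r ?L"
      "\<And>i. i < n \<Longrightarrow> is_face {..<m} (\<rho> i) \<sigma> \<Longrightarrow> diag_row D i \<in> P"
      using D unfolding diagrams_def by blast
    have "diag_row D' i \<in> P" if "i < n" "is_face {..<m} (\<rho> i) \<sigma>" for i
      using apartment_degenerates[OF P(1) P(2)[OF that] diagram_cell_degenerates[OF D' that(1)] row] .
    then show "\<exists>P\<in>apartments r ?L. \<forall>i<n. is_face {..<m} (\<rho> i) \<sigma> \<longrightarrow> diag_row D' i \<in> P"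
      using P(1) by blast
  qed
qed

lemma M_mat_carrier: "M_mat d r c D A \<in> carrier_mat d r"
  by (simp add: M_mat_def)

text \<open>
  The minimum over the support of a linear form is attained at an index of the support exactly if
  the entry there is at most every entry over the support; stated this way, the matrix visibly
  depends on the order of the entries in each row only.
\<close>

lemma M_mat_entry:
  assumes "k < d" "j < r"
  shows "M_mat d r c D A $$ (k, j) =
    (if \<forall>i\<in>A. \<forall>j'<r. c k j' \<noteq> 0 \<longrightarrow> D (i, j) \<le> D (i, j') then c k j else 0)"
proof (cases "c k j = 0")
  case False
  have "diag_row D i j = Min {diag_row D i j' | j'. j' < r \<and> c k j' \<noteq> 0} \<longleftrightarrow>
      (\<forall>j'<r. c k j' \<noteq> 0 \<longrightarrow> D (i, j) \<le> D (i, j'))" for i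
  proof -
    let ?X = "{diag_row D i j' | j'. j' < r \<and> c k j' \<noteq> 0}"
    have "finite ?X" by simp
    moreover have "diag_row D i j \<in> ?X" using False assms(2) by blast
    ultimately have "diag_row D i j = Min ?X \<longleftrightarrow> (\<forall>x\<in>?X. diag_row D i j \<le> x)"
      using eq_Min_iff[of ?X "diag_row D i j"] by blast
    then show ?thesis by (auto simp: diag_row_def)
  qed
  then show ?thesis using assms by (simp add: M_mat_def)
qed (use assms in \<open>simp add: M_mat_def\<close>)

text \<open>
  If the \<open>k\<close>-th row of the matrix of \<open>D\<close> is nonzero, some column attains the minima for all
  \<open>i \<in> A\<close> at once.  Therefore it is the initial form of \<open>\<ell>\<^sub>k\<close> for the single weight given by the
  sum of the rows \<open>i \<in> A\<close> of \<open>D\<close>.  In the degeneration \<open>D'\<close> minimal entries stay minimal, so this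
  row is also the initial form of the \<open>k\<close>-th row of the matrix of \<open>D'\<close>.
\<close>

lemma m_rank_degenerates_mono:
  assumes A: "A \<subseteq> {..<n}" and deg: "\<And>i. i < n \<Longrightarrow> degenerates r (diag_row D i) (diag_row D' i)"
  shows "m_rank d r c D A \<le> m_rank d r c D' A"
proof -
  have finA: "finite A" using A finite_subset by blast
  define w where "w j = (\<Sum>i\<in>A. D (i, j))" for j
  let ?M = "M_mat d r c D A" and ?M' = "M_mat d r c D' A"
  have rows: "(\<forall>j<r. ?M $$ (k, j) = 0) \<or>
      (\<exists>\<mu>. \<forall>j<r. ?M $$ (k, j) = (if w j = \<mu> then ?M' $$ (k, j) else 0) \<and>
        (?M' $$ (k, j) \<noteq> 0 \<longrightarrow> \<mu> \<le> w j))" if k: "k < d" for k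
  proof (cases "\<forall>j<r. ?M $$ (k, j) = 0")
    case True
    then show ?thesis ..
  next
    case False
    then obtain j0 where j0: "j0 < r" "?M $$ (k, j0) \<noteq> 0" by blast
    let ?min = "\<lambda>D j. \<forall>i\<in>A. \<forall>j'<r. c k j' \<noteq> 0 \<longrightarrow> D (i, j) \<le> D (i, j')"
    from j0(2) have c0: "c k j0 \<noteq> 0" and min0: "?min D j0"
      using M_mat_entry[OF k j0(1), of c D A] by (auto split: if_splits)
    have ge: "w j0 \<le> w j" if "j < r" "c k j \<noteq> 0" for j
      unfolding w_def using min0 that by (intro sum_mono) blast
    have eq: "?min D j \<longleftrightarrow> w j = w j0" if j: "j < r" "c k j \<noteq> 0" for j
    proof
      assume "?min D j"
      then have "w j \<le> w j0" unfolding w_def using c0 j0(1) by (intro sum_mono) blast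
      then show "w j = w j0" using ge[OF j] by simp
    next
      assume "w j = w j0"
      then have "D (i, j0) = D (i, j)" if "i \<in> A" for i
        using sum_mono_inv[of "\<lambda>i. D (i, j0)" A "\<lambda>i. D (i, j)" i] min0 j finA that
        unfolding w_def by simp
      then show "?min D j" using min0 by simp
    qed
    have min': "?min D' j" if j: "j < r" "?min D j" for j
    proof (intro ballI allI impI)
      fix i j' assume i: "i \<in> A" and j': "j' < r" "c k j' \<noteq> 0"
      then have "degenerates r (diag_row D i) (diag_row D' i)" using A deg by blast
      moreover have "D (i, j) \<le> D (i, j')" using j(2) i j' by blast
      ultimately show "D' (i, j) \<le> D' (i, j')"
        using j(1) j'(1) unfolding degenerates_def diag_row_def by blast
    qed
    have all: "?M $$ (k, j) = (if w j = w j0 then ?M' $$ (k, j) else 0) \<and>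
        (?M' $$ (k, j) \<noteq> 0 \<longrightarrow> w j0 \<le> w j)" if j: "j < r" for j
    proof (cases "c k j = 0")
      case True
      then show ?thesis using M_mat_entry[OF k j, of c D A] M_mat_entry[OF k j, of c D' A] by simp
    next
      case False
      show ?thesis
        unfolding M_mat_entry[OF k j] using eq[OF j False] min'[OF j] ge[OF j False] by simp
    qed
    show ?thesis by (intro disjI2 exI[of _ "w j0"] allI impI all)
  qed
  show ?thesis
    unfolding m_rank_def
    by (rule vec_space.rank_initial_matrix_le[OF M_mat_carrier M_mat_carrier rows])
qed

lemma m_rank_le: "m_rank d r c D A \<le> d"
  unfolding m_rank_def by (rule vec_space.rank_le_dim_row[OF M_mat_carrier])

definition rank_conditions ::
  "nat \<Rightarrow> nat \<Rightarrow> nat \<Rightarrow> (nat \<Rightarrow> nat \<Rightarrow> 'k::field) \<Rightarrow> (nat \<times> nat \<Rightarrow> rat) \<Rightarrow> bool" where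
  "rank_conditions n r d c D \<longleftrightarrow>
     (\<forall>A. A \<noteq> {} \<and> A \<subseteq> {..<n} \<longrightarrow> d < card A + m_rank d r c D A) \<and>
     (\<forall>B i. B \<subseteq> {..<n} \<and> card B \<ge> 2 \<and> i \<in> B \<longrightarrow>
        1 + m_rank d r c D {i} < card B + m_rank d r c D B)"

text \<open>
  Ranks can only grow under degeneration, which is favourable except for the term
  \<open>m_rank d r c D {i}\<close> on the small side of the second condition.  This term cannot grow: the
  first condition for \<open>A = {i}\<close> already forces it to have its maximal value \<open>d\<close>.
\<close>

lemma rank_conditions_degenerate:
  assumes D: "rank_conditions n r d c D"
    and deg: "\<And>i. i < n \<Longrightarrow> degenerates r (diag_row D i) (diag_row D' i)"
  shows "rank_conditions n r d c D'"
  unfolding rank_conditions_def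
proof (intro conjI allI impI; elim conjE)
  fix A :: "nat set" assume A: "A \<noteq> {}" "A \<subseteq> {..<n}"
  then have "d < card A + m_rank d r c D A" using D by (auto simp: rank_conditions_def)
  then show "d < card A + m_rank d r c D' A"
    using m_rank_degenerates_mono[OF A(2) deg, of d c] by linarith
next
  fix B :: "nat set" and i assume B: "B \<subseteq> {..<n}" "2 \<le> card B" "i \<in> B"
  have "d < card {i} + m_rank d r c D {i}"
    using D B unfolding rank_conditions_def by blast
  moreover have "1 + m_rank d r c D {i} < card B + m_rank d r c D B"
    using D B unfolding rank_conditions_def by blast
  \<comment> \<open>The first fact gives \<open>m_rank d r c D {i} \<ge> d\<close>.\<close>
  ultimately show "1 + m_rank d r c D' {i} < card B + m_rank d r c D' B"
    using m_rank_degenerates_mono[OF B(1) deg, of d c] m_rank_le[of d r c D' "{i}"] by simp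
qed

theorem proposition6p17:
  fixes scale :: "'k::alg_closed_field \<Rightarrow> 'e::ab_group_add \<Rightarrow> 'e"
    and b :: "nat \<Rightarrow> 'e"
    and \<Sigma> :: "(nat \<Rightarrow> rat) set set"
    and \<rho> :: "nat \<Rightarrow> (nat \<Rightarrow> rat) set"
    and L :: "'k mpol set"
    and m n r d :: nat
  assumes "smooth_fan m \<Sigma>"
    and "bij_betw \<rho> {..<n} (rays \<Sigma>)"
    and "vector_space scale"
    and "Modules.module.span scale (b ` {..<r}) = UNIV"
    and "L = relation_ideal scale r b"
    and "\<exists>c. minimal_linear_generators r L d c"
  shows "\<exists>\<F>. finite \<F> \<and> is_fan ({..<n} \<times> {..<r}) \<F> \<and>
           \<Union>\<F> = diagrams m \<Sigma> n \<rho> r L \<and>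
           (\<exists>\<G>\<subseteq>\<F>.
              {D \<in> diagrams m \<Sigma> n \<rho> r L.
                 \<exists>c. minimal_linear_generators r L d c \<and>
                   (\<forall>A. A \<noteq> {} \<and> A \<subseteq> {..<n} \<longrightarrow> d < card A + m_rank d r c D A) \<and>
                   (\<forall>B i. B \<subseteq> {..<n} \<and> card B \<ge> 2 \<and> i \<in> B \<longrightarrow>
                      1 + m_rank d r c D {i} < card B + m_rank d r c D B)}
              = \<Union>\<G>)"
proof -
  let ?I = "{..<n} \<times> {..<r}" and ?H = "diagram_normals n r"
  define \<Delta> where "\<Delta> = diagrams m \<Sigma> n \<rho> r L"
  define S where "S = {D \<in> \<Delta>. \<exists>c. minimal_linear_generators r L d c \<and> rank_conditions n r d c D}"
  interpret vector_space scale by (rule assms(3))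
  interpret arrangement ?I ?H by (rule arrangement_diagram_normals)
  have \<Delta>q: "\<Delta> \<subseteq> qspace ?I" by (auto simp: \<Delta>_def diagrams_def)
  have \<Delta>: "cell ?I ?H D \<subseteq> \<Delta>" if "D \<in> \<Delta>" for D
    using diagrams_cell_closed that unfolding \<Delta>_def assms(5) by blast
  have S\<Delta>: "S \<subseteq> \<Delta>" by (auto simp: S_def)
  have S: "cell ?I ?H D \<subseteq> S" if "D \<in> S" for D
  proof
    fix D' assume D': "D' \<in> cell ?I ?H D"
    then have "D' \<in> \<Delta>" using \<Delta> that S\<Delta> by blast
    then show "D' \<in> S"
      using that rank_conditions_degenerate diagram_cell_degenerates[OF D'] unfolding S_def by blast
  qed
  have "finite (cell ?I ?H ` \<Delta>)" by (rule finite_cells)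
  moreover have "is_fan ?I (cell ?I ?H ` \<Delta>)" using \<Delta>q \<Delta> by (rule is_fan_cells)
  moreover have "\<Union>(cell ?I ?H ` \<Delta>) = \<Delta>" using \<Delta>q \<Delta> by (rule Union_cells)
  moreover have "cell ?I ?H ` S \<subseteq> cell ?I ?H ` \<Delta>" using S\<Delta> by (rule image_mono)
  moreover have "S = \<Union>(cell ?I ?H ` S)" using Union_cells[OF order.trans[OF S\<Delta> \<Delta>q] S] by simp
  ultimately show ?thesis
    unfolding S_def rank_conditions_def \<Delta>_def by meson
qed

end
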